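(* Let $f=f(x,y)$ be a smooth function with $\partial^2_{xx}f\neq 0$ at every point, and let $(M,g_f)$ be the three-dimensional strictly Walker manifold with coordinates $(t,x,y)$ and metric $g_f=2\,dt\,dy+dx^2+f(x,y)\,dy^2$. Let $X=X_1\partial_t+X_2\partial_x+X_3\partial_y$ be a smooth vector field on $M$. Then: (i) $X$ is a Killing vector field if and only if there exist real constants $c_1,c_2$ and smooth functions $f_1,f_2$ of $y$ such that $$X_1=-c_1t-xf_1'(y)+f_2(y),\qquad X_2=f_1(y),\qquad X_3=c_1y+c_2,$$ and $$2c_1f-2f_1''(y)x+2f_2'(y)+f_1(y)\partial_xf+(c_1y+c_2)\partial_yf=0.$$ (ii) $X$ is a homothetic, non-Killing vector field if and only if there exist a real constant $\eta\neq 0$, real constants $c_1,c_2$ and smooth functions $f_1,f_2$ of $y$ such that $$X_1=\eta t-c_1t-xf_1'(y)+f_2(y),\qquad X_2=\tfrac{\eta}{2}x+f_1(y),\qquad X_3=c_1y+c_2,$$ and $$(2c_1-\eta)f-2f_1''(y)x+2f_2'(y)+\left(\tfrac{\eta}{2}x+f_1(y)\right)\partial_xf+(c_1y+c_2)\partial_yf=0.$$ (iii) $X$ is an affine vector field if and only if there exist real constants $c_1,c_2,c_3,c_4$ and smooth functions $f_1,f_2$ of $y$ such that $$X_1=c_3t-xf_1'(y)+f_2(y),\qquad X_2=\tfrac{c_1+c_3}{2}x+f_1(y),\qquad X_3=c_1y+c_2,$$ and $$(c_1-c_3)f-2f_1''(y)x+2f_2'(y)+\left(\tfrac{c_1+c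_3}{2}x+f_1(y)\right)\partial_xf+(c_1y+c_2)\partial_yf+c_4=0.$$
   Context: The statement is local: the coordinates $(t,x,y)$ range over a product of open intervals. In the coordinate frame, $g_f(\partial_t,\partial_y)=1$, $g_f(\partial_x,\partial_x)=1$, $g_f(\partial_y,\partial_y)=f(x,y)$, and all other components vanish; this is a Lorentzian metric. Let $\mathcal L$ denote the Lie derivative and $\nabla$ the Levi-Civita connection of $g_f$. A vector field $X$ is Killing if $\mathcal L_Xg_f=0$; homothetic if $\mathcal L_Xg_f=\eta g_f$ for some real constant $\eta$; affine (also called affine Killing) if $\mathcal L_X\nabla=0$. In (ii), $\eta$ is this homothety constant. *)

theory Defs
  imports "HOL-Analysis.Analysis"
begin

section \<open>Smooth maps on open sets\<close>

text \<open>The definition is meant for open subsets of finite-dimensional spaces only: the derivatives are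
  full (two-sided) derivatives at the points of the set, and their continuity is tested direction
  by direction.\<close>

primrec Ck_on :: "nat \<Rightarrow> 'a set \<Rightarrow> ('a::euclidean_space \<Rightarrow> 'b::euclidean_space) \<Rightarrow> bool" where
  "Ck_on 0 S f \<longleftrightarrow> continuous_on S f"
| "Ck_on (Suc n) S f \<longleftrightarrow>
     (\<forall>x\<in>S. f differentiable (at x)) \<and> (\<forall>v. Ck_on n S (\<lambda>x. frechet_derivative f (at x) v))"

definition smooth_on :: "'a set \<Rightarrow> ('a::euclidean_space \<Rightarrow> 'b::euclidean_space) \<Rightarrow> bool" where
  "smooth_on S f \<longleftrightarrow> (\<forall>n. Ck_on n S f)"

section \<open>Tensor calculus on an open subset of coordinate space\<close>

text \<open>A vector field is given by its components in the coordinate frame, and a metric by its Gram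
  matrix in that frame.\<close>

definition partial :: "'n \<Rightarrow> (real^'n \<Rightarrow> real) \<Rightarrow> real^'n \<Rightarrow> real" where
  "partial i h p = frechet_derivative h (at p) (axis i 1)"

definition metric_app :: "(real^'n \<Rightarrow> real^'n^'n) \<Rightarrow> (real^'n \<Rightarrow> real^'n) \<Rightarrow> (real^'n \<Rightarrow> real^'n) \<Rightarrow> real^'n \<Rightarrow> real" where
  "metric_app g Y Z p = (\<Sum>i\<in>UNIV. \<Sum>j\<in>UNIV. g p $ i $ j * Y p $ i * Z p $ j)"

definition vf_apply :: "(real^'n \<Rightarrow> real^'n) \<Rightarrow> (real^'n \<Rightarrow> real) \<Rightarrow> real^'n \<Rightarrow> real" where
  "vf_apply X h p = frechet_derivative h (at p) (X p)"

definition lie_bracket :: "(real^'n \<Rightarrow> real^'n) \<Rightarrow> (real^'n \<Rightarrow> real^'n) \<Rightarrow> real^'n \<Rightarrow> real^'n" where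
  "lie_bracket X Y p = frechet_derivative Y (at p) (X p) - frechet_derivative X (at p) (Y p)"

text \<open>\<open>(\<L>\<^sub>X g)(Y, Z) = X(g(Y, Z)) - g([X, Y], Z) - g(Y, [X, Z])\<close>\<close>

definition lie_metric ::
  "(real^'n \<Rightarrow> real^'n^'n) \<Rightarrow> (real^'n \<Rightarrow> real^'n) \<Rightarrow> (real^'n \<Rightarrow> real^'n) \<Rightarrow> (real^'n \<Rightarrow> real^'n) \<Rightarrow> real^'n \<Rightarrow> real" where
  "lie_metric g X Y Z p = vf_apply X (metric_app g Y Z) p
     - metric_app g (lie_bracket X Y) Z p - metric_app g Y (lie_bracket X Z) p"

text \<open>\<open>christoffel g k i j\<close> is the Christoffel symbol with upper index \<open>k\<close> and lower indices \<open>i\<close>, \<open>j\<close>.\<close>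

definition christoffel :: "(real^'n \<Rightarrow> real^'n^'n) \<Rightarrow> 'n \<Rightarrow> 'n \<Rightarrow> 'n \<Rightarrow> real^'n \<Rightarrow> real" where
  "christoffel g k i j p = (1/2) * (\<Sum>l\<in>UNIV. matrix_inv (g p) $ k $ l *
     (partial i (\<lambda>q. g q $ j $ l) p + partial j (\<lambda>q. g q $ i $ l) p - partial l (\<lambda>q. g q $ i $ j) p))"

definition levi_civita ::
  "(real^'n \<Rightarrow> real^'n^'n) \<Rightarrow> (real^'n \<Rightarrow> real^'n) \<Rightarrow> (real^'n \<Rightarrow> real^'n) \<Rightarrow> real^'n \<Rightarrow> real^'n" where
  "levi_civita g Y Z p = frechet_derivative Z (at p) (Y p)
     + (\<chi> k. \<Sum>i\<in>UNIV. \<Sum>j\<in>UNIV. christoffel g k i j p * Y p $ i * Z p $ j)"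

text \<open>\<open>(\<L>\<^sub>X \<nabla>)(Y, Z) = [X, \<nabla>\<^sub>Y Z] - \<nabla>\<^bsub>[X, Y]\<^esub> Z - \<nabla>\<^sub>Y [X, Z]\<close>\<close>

definition lie_connection ::
  "((real^'n \<Rightarrow> real^'n) \<Rightarrow> (real^'n \<Rightarrow> real^'n) \<Rightarrow> real^'n \<Rightarrow> real^'n) \<Rightarrow>
    (real^'n \<Rightarrow> real^'n) \<Rightarrow> (real^'n \<Rightarrow> real^'n) \<Rightarrow> (real^'n \<Rightarrow> real^'n) \<Rightarrow> real^'n \<Rightarrow> real^'n" where
  "lie_connection nab X Y Z p = lie_bracket X (nab Y Z) p
     - nab (lie_bracket X Y) Z p - nab Y (lie_bracket X Z) p"

definition killing_on :: "(real^'n) set \<Rightarrow> (real^'n \<Rightarrow> real^'n^'n) \<Rightarrow> (real^'n \<Rightarrow> real^'n) \<Rightarrow> bool" where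
  "killing_on M g X \<longleftrightarrow>
     (\<forall>Y Z. smooth_on M Y \<longrightarrow> smooth_on M Z \<longrightarrow> (\<forall>p\<in>M. lie_metric g X Y Z p = 0))"

definition homothetic_const_on :: "(real^'n) set \<Rightarrow> (real^'n \<Rightarrow> real^'n^'n) \<Rightarrow> real \<Rightarrow> (real^'n \<Rightarrow> real^'n) \<Rightarrow> bool" where
  "homothetic_const_on M g \<eta> X \<longleftrightarrow>
     (\<forall>Y Z. smooth_on M Y \<longrightarrow> smooth_on M Z \<longrightarrow> (\<forall>p\<in>M. lie_metric g X Y Z p = \<eta> * metric_app g Y Z p))"

definition homothetic_on :: "(real^'n) set \<Rightarrow> (real^'n \<Rightarrow> real^'n^'n) \<Rightarrow> (real^'n \<Rightarrow> real^'n) \<Rightarrow> bool" where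
  "homothetic_on M g X \<longleftrightarrow> (\<exists>\<eta>. homothetic_const_on M g \<eta> X)"

definition affine_vf_on :: "(real^'n) set \<Rightarrow> (real^'n \<Rightarrow> real^'n^'n) \<Rightarrow> (real^'n \<Rightarrow> real^'n) \<Rightarrow> bool" where
  "affine_vf_on M g X \<longleftrightarrow>
     (\<forall>Y Z. smooth_on M Y \<longrightarrow> smooth_on M Z \<longrightarrow> (\<forall>p\<in>M. lie_connection (levi_civita g) X Y Z p = 0))"

section \<open>Strictly Walker metrics in dimension three\<close>

text \<open>The coordinates \<open>(t, x, y)\<close> of a point \<open>p\<close> are \<open>p $ 1\<close>, \<open>p $ 2\<close>, \<open>p $ 3\<close>.\<close>

definition coord_box :: "real set \<Rightarrow> real set \<Rightarrow> real set \<Rightarrow> (real^3) set" where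
  "coord_box T I J = {p. p $ 1 \<in> T \<and> p $ 2 \<in> I \<and> p $ 3 \<in> J}"

definition walker_metric :: "(real \<Rightarrow> real \<Rightarrow> real) \<Rightarrow> real^3 \<Rightarrow> real^3^3" where
  "walker_metric f p = vector [vector [0, 0, 1], vector [0, 1, 0], vector [1, 0, f (p $ 2) (p $ 3)]]"

text \<open>Nonempty open intervals, bounded or not.\<close>

definition open_interval :: "real set \<Rightarrow> bool" where
  "open_interval I \<longleftrightarrow> open I \<and> is_interval I \<and> I \<noteq> {}"

definition dx :: "(real \<Rightarrow> real \<Rightarrow> real) \<Rightarrow> real \<Rightarrow> real \<Rightarrow> real" where
  "dx f x y = deriv (\<lambda>s. f s y) x"

definition dy :: "(real \<Rightarrow> real \<Rightarrow> real) \<Rightarrow> real \<Rightarrow> real \<Rightarrow> real" where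
  "dy f x y = deriv (\<lambda>s. f x s) y"

end

theory Submission
  imports Defs
begin

text \<open>Writing \<open>X = u \<partial>\<^sub>t + v \<partial>\<^sub>x + w \<partial>\<^sub>y\<close>, the homothetic and the affine condition are tensorial, so they amount to linear
  partial differential equations for \<open>u, v, w\<close>: six for \<open>\<L>\<^sub>X g = \<eta> g\<close> and eighteen for \<open>\<L>\<^sub>X \<nabla> = 0\<close>.
  Differentiating them further and using \<open>f\<^sub>x\<^sub>x \<noteq> 0\<close> at each stage to cancel a factor forces
  \<open>w\<^sub>t = w\<^sub>x = v\<^sub>t = 0\<close>, \<open>w\<^sub>y\<close>, \<open>v\<^sub>x\<close>, \<open>u\<^sub>t\<close> constant and \<open>u\<^sub>x = - v\<^sub>y\<close>, which integrates to the stated form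
  of \<open>X\<close>. In the homothetic case one equation remains. In the affine case the two remaining
  equations say that the \<open>x\<close>- and \<open>y\<close>-derivatives of the left-hand side of that equation vanish,
  which produces the constant \<open>c4\<close>.\<close>

section \<open>Calculus of smooth maps\<close>

text \<open>The conditions quantify over arbitrary smooth fields and are written with brackets, so
  the bracket of \<open>X\<close> with the covariant derivative of \<open>Z\<close> along
  \<open>Y\<close> contains second derivatives of \<open>Z\<close>. They drop out only because
  second derivatives commute, and the same symmetry links the equations for the components of
  \<open>X\<close>; hence its proof at the outset. Every use of f_xx follows one pattern: an unknown
  q occurs as q f_x in an equation, while q_x and the x-derivatives of the other terms already
  vanish. One more x-derivative leaves q f_xx = 0. The affine case has an extra obstacle. The
  homothetic equations contain u_x + v_y + f w_x = 0, whereas the affine ones at first only make u_x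
  + v_y constant; that the constant is 0 is an integrability condition. The coefficient (c1 + c3)/2
  of x comes from adding two affine equations, in which the terms with second derivatives of f
  cancel.\<close>

lemma frechet_derivative_eqI:
  "(f has_derivative f') (at x) \<Longrightarrow> frechet_derivative f (at x) v = f' v"
  using frechet_derivative_at by metis

text \<open>Openness of \<open>S\<close> is the point: \<open>frechet_derivative\<close> at a point
  of \<open>S\<close> sees a whole neighbourhood, so agreement on \<open>S\<close> passes to
  derivatives only if \<open>S\<close> contains one.\<close>

lemma Ck_on_cong:
  assumes "open S" "\<And>x. x \<in> S \<Longrightarrow> f x = g x" "Ck_on n S f"
  shows "Ck_on n S g"
  using assms(2,3)
proof (induction n arbitrary: f g)
  case 0
  then show ?case using continuous_on_eq by (metis Ck_on.simps(1))
next
  case (Suc n)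
  have "(g has_derivative frechet_derivative f (at x)) (at x)" if "x \<in> S" for x
    using Suc.prems(2) that
    by (intro has_derivative_transform_within_open[OF _ assms(1) that Suc.prems(1)])
      (simp_all add: frechet_derivative_works)
  note der = this
  have "Ck_on n S (\<lambda>x. frechet_derivative g (at x) v)" for v
  proof (rule Suc.IH)
    show "Ck_on n S (\<lambda>x. frechet_derivative f (at x) v)" using Suc.prems(2) by simp
  qed (simp add: frechet_derivative_eqI[OF der])
  then show ?case by (auto intro!: differentiableI der)
qed

text \<open>The recursion for \<open>Suc n\<close> mentions the derivatives of \<open>f\<close> but
  not \<open>f\<close> itself at level \<open>n\<close>. The product rule needs the latter, as its
  summands contain undifferentiated factors.\<close>

lemma Ck_on_Suc_imp: "Ck_on (Suc n) S f \<Longrightarrow> Ck_on n S f"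
proof (induction n arbitrary: f)
  case 0
  then show ?case
    using continuous_at_imp_continuous_on differentiable_imp_continuous_within by fastforce
next
  case (Suc n)
  have "Ck_on n S (\<lambda>x. frechet_derivative f (at x) v)" for v
    using Suc.prems by (intro Suc.IH) simp
  with Suc.prems show ?case by simp
qed

text \<open>Lets the formula of a differentiation rule, valid on \<open>S\<close>, replace
  \<open>frechet_derivative\<close>; each closure rule below is an induction through this
  step.\<close>

lemma Ck_on_SucI:
  assumes "open S" "\<And>x. x \<in> S \<Longrightarrow> (f has_derivative f' x) (at x)" "\<And>v. Ck_on n S (\<lambda>x. f' x v)"
  shows "Ck_on (Suc n) S f"
proof -
  have "Ck_on n S (\<lambda>x. frechet_derivative f (at x) v)" for v
    by (rule Ck_on_cong[OF assms(1) _ assms(3)[of v]]) (simp add: frechet_derivative_eqI[OF assms(2)])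
  then show ?thesis by (auto intro!: differentiableI assms(2))
qed

lemma Ck_on_SucD:
  assumes "Ck_on (Suc n) S f"
  shows "x \<in> S \<Longrightarrow> (f has_derivative frechet_derivative f (at x)) (at x)"
    and "Ck_on n S (\<lambda>x. frechet_derivative f (at x) v)"
  using assms by (simp_all add: frechet_derivative_works)

lemma Ck_on_const: "Ck_on n S (\<lambda>x. c)"
  by (induction n arbitrary: c) auto

lemma Ck_on_linear:
  assumes "open S" "bounded_linear A"
  shows "Ck_on n S f \<Longrightarrow> Ck_on n S (\<lambda>x. A (f x))"
proof (induction n arbitrary: f)
  case 0
  then show ?case using assms(2) by (simp add: bounded_linear.continuous_on)
next
  case (Suc n)
  show ?case
    by (rule Ck_on_SucI[OF assms(1), where f' = "\<lambda>x v. A (frechet_derivative f (at x) v)"])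
      (intro bounded_linear.has_derivative[OF assms(2)] Suc.IH Ck_on_SucD[OF Suc.prems]; assumption)+
qed

lemma Ck_on_add:
  assumes "open S"
  shows "Ck_on n S f \<Longrightarrow> Ck_on n S g \<Longrightarrow> Ck_on n S (\<lambda>x. f x + g x)"
proof (induction n arbitrary: f g)
  case 0
  then show ?case by (simp add: continuous_on_add)
next
  case (Suc n)
  show ?case
    by (rule Ck_on_SucI[OF assms(1),
          where f' = "\<lambda>x v. frechet_derivative f (at x) v + frechet_derivative g (at x) v"])
      (intro has_derivative_add Suc.IH Ck_on_SucD[OF Suc.prems(1)] Ck_on_SucD[OF Suc.prems(2)]; assumption)+
qed

lemma Ck_on_mult:
  fixes f g :: "'a::euclidean_space \<Rightarrow> real"
  assumes "open S"
  shows "Ck_on n S f \<Longrightarrow> Ck_on n S g \<Longrightarrow> Ck_on n S (\<lambda>x. f x * g x)"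
proof (induction n arbitrary: f g)
  case 0
  then show ?case by (simp add: continuous_on_mult)
next
  case (Suc n)
  show ?case
    by (rule Ck_on_SucI[OF assms(1),
          where f' = "\<lambda>x v. f x * frechet_derivative g (at x) v + frechet_derivative f (at x) v * g x"])
      (intro has_derivative_mult Ck_on_add[OF assms] Suc.IH Ck_on_SucD[OF Suc.prems(1)]
        Ck_on_SucD[OF Suc.prems(2)] Ck_on_Suc_imp[OF Suc.prems(1)] Ck_on_Suc_imp[OF Suc.prems(2)];
        assumption)+
qed

text \<open>The inner map has constant derivative \<open>A\<close>, so differentiating in direction
  \<open>v\<close> gives the same kind of composite with the derivative of \<open>f\<close> in the
  fixed direction \<open>A v\<close>, and the induction closes. Coordinate projections and
  coordinate lines are both of this form.\<close>

lemma Ck_on_affine_compose: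
  assumes "open S" "bounded_linear A" "\<And>x. x \<in> S \<Longrightarrow> c + A x \<in> S'"
  shows "Ck_on n S' f \<Longrightarrow> Ck_on n S (\<lambda>x. f (c + A x))"
proof (induction n arbitrary: f)
  case 0
  have "continuous_on S (\<lambda>x. c + A x)"
    using assms(2) by (intro continuous_on_add continuous_on_const linear_continuous_on)
  with 0 assms(3) show ?case by (auto intro!: continuous_on_compose2[of S' f])
next
  case (Suc n)
  have "((\<lambda>x. c + A x) has_derivative A) (at x)" for x
    using has_derivative_add[OF has_derivative_const bounded_linear_imp_has_derivative[OF assms(2)]]
    by simp
  then have "((\<lambda>x. f (c + A x)) has_derivative (\<lambda>v. frechet_derivative f (at (c + A x)) (A v))) (at x)"
    if "x \<in> S" for x
    using has_derivative_compose Ck_on_SucD(1)[OF Suc.prems] assms(3)[OF that] by blast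
  then show ?case
    by (rule Ck_on_SucI[OF assms(1)]) (use Suc.IH Ck_on_SucD(2)[OF Suc.prems] in auto)
qed

lemma smooth_on_frechet: "smooth_on S f \<Longrightarrow> smooth_on S (\<lambda>x. frechet_derivative f (at x) v)"
  unfolding smooth_on_def using Ck_on_SucD(2) by blast

lemma smooth_on_has_derivative:
  "smooth_on S f \<Longrightarrow> x \<in> S \<Longrightarrow> (f has_derivative frechet_derivative f (at x)) (at x)"
  unfolding smooth_on_def using Ck_on_SucD(1) by blast

lemma smooth_on_cong:
  "open S \<Longrightarrow> (\<And>x. x \<in> S \<Longrightarrow> f x = g x) \<Longrightarrow> smooth_on S f \<Longrightarrow> smooth_on S g"
  unfolding smooth_on_def using Ck_on_cong by blast

lemma smooth_on_const: "smooth_on S (\<lambda>x. c)"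
  by (simp add: smooth_on_def Ck_on_const)

lemma smooth_on_linear: "open S \<Longrightarrow> bounded_linear A \<Longrightarrow> smooth_on S f \<Longrightarrow> smooth_on S (\<lambda>x. A (f x))"
  by (simp add: smooth_on_def Ck_on_linear)

lemma smooth_on_add: "open S \<Longrightarrow> smooth_on S f \<Longrightarrow> smooth_on S g \<Longrightarrow> smooth_on S (\<lambda>x. f x + g x)"
  by (simp add: smooth_on_def Ck_on_add)

lemma smooth_on_mult:
  fixes f g :: "'a::euclidean_space \<Rightarrow> real"
  shows "open S \<Longrightarrow> smooth_on S f \<Longrightarrow> smooth_on S g \<Longrightarrow> smooth_on S (\<lambda>x. f x * g x)"
  by (simp add: smooth_on_def Ck_on_mult)

lemma smooth_on_diff:
  "open S \<Longrightarrow> smooth_on S f \<Longrightarrow> smooth_on S g \<Longrightarrow> smooth_on S (\<lambda>x. f x - g x)"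
  using smooth_on_add[of S f "\<lambda>x. - g x"] smooth_on_linear[of S uminus g]
  by (simp add: bounded_linear_minus bounded_linear_ident)

lemma smooth_on_affine_compose:
  "open S \<Longrightarrow> bounded_linear A \<Longrightarrow> (\<And>x. x \<in> S \<Longrightarrow> c + A x \<in> S') \<Longrightarrow> smooth_on S' f
    \<Longrightarrow> smooth_on S (\<lambda>x. f (c + A x))"
  unfolding smooth_on_def using Ck_on_affine_compose[of S A c S' _ f] by simp

lemma smooth_on_imp_continuous_on: "smooth_on S f \<Longrightarrow> continuous_on S f"
  unfolding smooth_on_def by (metis Ck_on.simps(1))

section \<open>Symmetry of second derivatives\<close>

lemma second_difference_mvt:
  fixes F :: "'a::euclidean_space \<Rightarrow> real"
  assumes F: "smooth_on S F" and h: "h > 0"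
    and S: "\<And>s t. 0 \<le> s \<Longrightarrow> s \<le> h \<Longrightarrow> 0 \<le> t \<Longrightarrow> t \<le> h \<Longrightarrow> p + s *\<^sub>R u + t *\<^sub>R v \<in> S"
  obtains s t where "0 \<le> s" "s \<le> h" "0 \<le> t" "t \<le> h"
    "F (p + h *\<^sub>R u + h *\<^sub>R v) - F (p + h *\<^sub>R u) - F (p + h *\<^sub>R v) + F p
      = h * h * frechet_derivative (\<lambda>q. frechet_derivative F (at q) u) (at (p + s *\<^sub>R u + t *\<^sub>R v)) v"
proof -
  let ?G = "\<lambda>q. frechet_derivative F (at q) u"
  have lin: "linear (frechet_derivative H (at q))" if "smooth_on S H" "q \<in> S" for q and H :: "'a \<Rightarrow> real"
    by (rule has_derivative_linear[OF smooth_on_has_derivative[OF that]])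
  have d1: "((\<lambda>s. F (p + s *\<^sub>R u + t *\<^sub>R v)) has_derivative (\<lambda>r. r * ?G (p + s *\<^sub>R u + t *\<^sub>R v))) (at s)"
    if "0 \<le> s" "s \<le> h" "0 \<le> t" "t \<le> h" for s t
  proof -
    have "((\<lambda>s. p + s *\<^sub>R u + t *\<^sub>R v) has_derivative (\<lambda>r. r *\<^sub>R u)) (at s)"
      by (rule derivative_eq_intros refl | simp)+
    from has_derivative_compose[OF this smooth_on_has_derivative[OF F S[OF that]]]
    show ?thesis using linear_scale[OF lin[OF F S[OF that]]] by simp
  qed
  note G = smooth_on_frechet[OF F, of u]
  have d2: "((\<lambda>t. ?G (p + s *\<^sub>R u + t *\<^sub>R v)) has_derivative
      (\<lambda>r. r * frechet_derivative ?G (at (p + s *\<^sub>R u + t *\<^sub>R v)) v)) (at t)"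
    if "0 \<le> s" "s \<le> h" "0 \<le> t" "t \<le> h" for s t
  proof -
    have "((\<lambda>t. p + s *\<^sub>R u + t *\<^sub>R v) has_derivative (\<lambda>r. r *\<^sub>R v)) (at t)"
      by (rule derivative_eq_intros refl | simp)+
    from has_derivative_compose[OF this smooth_on_has_derivative[OF G S[OF that]]]
    show ?thesis using linear_scale[OF lin[OF G S[OF that]]] by simp
  qed
  \<comment> \<open>The mean value theorem is applied in \<open>s\<close> to the increment of
    \<open>F\<close> along \<open>v\<close>, and below in \<open>t\<close> to the resulting
    increment of \<open>?G\<close>. The term \<open>0 *\<^sub>R v\<close> is kept so that
    \<open>d1\<close> fits both t = h and t = 0.\<close>
  have "((\<lambda>s. F (p + s *\<^sub>R u + h *\<^sub>R v) - F (p + s *\<^sub>R u + 0 *\<^sub>R v)) has_derivative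
      (\<lambda>r. r * ?G (p + s *\<^sub>R u + h *\<^sub>R v) - r * ?G (p + s *\<^sub>R u + 0 *\<^sub>R v))) (at s within {0..h})"
    if "0 \<le> s" "s \<le> h" for s
    using that h by (intro has_derivative_at_withinI[OF has_derivative_diff] d1) auto
  from mvt_simple[OF h this] obtain s where s: "s \<in> {0<..<h}" and
    e1: "F (p + h *\<^sub>R u + h *\<^sub>R v) - F (p + h *\<^sub>R u + 0 *\<^sub>R v)
        - (F (p + 0 *\<^sub>R u + h *\<^sub>R v) - F (p + 0 *\<^sub>R u + 0 *\<^sub>R v))
      = (h - 0) * ?G (p + s *\<^sub>R u + h *\<^sub>R v) - (h - 0) * ?G (p + s *\<^sub>R u + 0 *\<^sub>R v)"
    by blast
  have "((\<lambda>t. ?G (p + s *\<^sub>R u + t *\<^sub>R v)) has_derivative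
      (\<lambda>r. r * frechet_derivative ?G (at (p + s *\<^sub>R u + t *\<^sub>R v)) v)) (at t within {0..h})"
    if "0 \<le> t" "t \<le> h" for t
    using that s by (intro has_derivative_at_withinI[OF d2]) auto
  from mvt_simple[OF h this] obtain t where t: "t \<in> {0<..<h}" and
    e2: "?G (p + s *\<^sub>R u + h *\<^sub>R v) - ?G (p + s *\<^sub>R u + 0 *\<^sub>R v)
      = (h - 0) * frechet_derivative ?G (at (p + s *\<^sub>R u + t *\<^sub>R v)) v"
    by blast
  have "F (p + h *\<^sub>R u + h *\<^sub>R v) - F (p + h *\<^sub>R u) - F (p + h *\<^sub>R v) + F p
      = h * (?G (p + s *\<^sub>R u + h *\<^sub>R v) - ?G (p + s *\<^sub>R u + 0 *\<^sub>R v))"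
    using e1 by (simp add: algebra_simps)
  also have "\<dots> = h * h * frechet_derivative ?G (at (p + s *\<^sub>R u + t *\<^sub>R v)) v"
    unfolding e2 by simp
  finally show thesis using that[of s t] s t by simp
qed

text \<open>The second difference over a small parallelogram does not change when \<open>u\<close>
  and \<open>v\<close> are exchanged. Divided by h * h it is a value of either mixed derivative near
  \<open>p\<close>, and by continuity both values lie within half the supposed gap of their
  limits.\<close>

lemma frechet_derivative_symmetric_real:
  fixes F :: "'a::euclidean_space \<Rightarrow> real"
  assumes F: "smooth_on S F" and S: "open S" "p \<in> S"
  shows "frechet_derivative (\<lambda>q. frechet_derivative F (at q) u) (at p) v
    = frechet_derivative (\<lambda>q. frechet_derivative F (at q) v) (at p) u"
proof (rule ccontr)
  define A where "A = (\<lambda>q. frechet_derivative (\<lambda>q. frechet_derivative F (at q) u) (at q) v)"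
  define B where "B = (\<lambda>q. frechet_derivative (\<lambda>q. frechet_derivative F (at q) v) (at q) u)"
  assume "\<not> ?thesis"
  then have ne: "A p \<noteq> B p" by (simp add: A_def B_def)
  define e where "e = \<bar>A p - B p\<bar> / 2"
  have e: "e > 0" using ne by (simp add: e_def)
  have sm: "smooth_on S A" "smooth_on S B"
    unfolding A_def B_def using F by (auto intro!: smooth_on_frechet)
  have "continuous (at p) A" "continuous (at p) B"
    using smooth_on_imp_continuous_on[OF sm(1)] smooth_on_imp_continuous_on[OF sm(2)] S
    by (auto simp: continuous_on_eq_continuous_at)
  then have "\<exists>d>0. \<forall>q. dist q p < d \<longrightarrow> dist (A q) (A p) < e"
    "\<exists>d>0. \<forall>q. dist q p < d \<longrightarrow> dist (B q) (B p) < e"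
    using e unfolding continuous_at_eps_delta dist_norm by simp_all
  then obtain d1 d2 where d12: "d1 > 0" "d2 > 0"
    "\<And>q. dist q p < d1 \<Longrightarrow> dist (A q) (A p) < e" "\<And>q. dist q p < d2 \<Longrightarrow> dist (B q) (B p) < e"
    by blast
  obtain d3 where d3: "d3 > 0" "\<And>q. dist q p < d3 \<Longrightarrow> q \<in> S"
    using S unfolding open_dist by blast
  define d where "d = min d1 (min d2 d3)"
  \<comment> \<open>The summand 1 keeps \<open>K\<close> positive when both vectors vanish and makes
    the estimate \<open>near\<close> strict.\<close>
  define K where "K = norm u + norm v + 1"
  have K: "K > 0" by (simp add: K_def add_nonneg_pos)
  define h where "h = d / K"
  have d: "d > 0" using d12 d3 by (simp add: d_def)
  have h: "h > 0" using d K by (simp add: h_def)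
  have near: "dist (p + s *\<^sub>R u + t *\<^sub>R v) p < d" if "0 \<le> s" "s \<le> h" "0 \<le> t" "t \<le> h" for s t
  proof -
    have "dist (p + s *\<^sub>R u + t *\<^sub>R v) p = norm (s *\<^sub>R u + t *\<^sub>R v)" by (simp add: dist_norm add.assoc)
    also have "\<dots> \<le> s * norm u + t * norm v"
      using norm_triangle_ineq[of "s *\<^sub>R u" "t *\<^sub>R v"] that by simp
    also have "\<dots> \<le> h * norm u + h * norm v"
      using that by (intro add_mono mult_right_mono) auto
    also have "\<dots> < h * K" using h by (simp add: K_def algebra_simps)
    also have "\<dots> = d" using K by (simp add: h_def)
    finally show ?thesis .
  qed
  have inS: "p + s *\<^sub>R u + t *\<^sub>R v \<in> S" "p + t *\<^sub>R v + s *\<^sub>R u \<in> S"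
    if "0 \<le> s" "s \<le> h" "0 \<le> t" "t \<le> h" for s t
    using near[OF that] d3(2) by (auto simp: d_def add_ac)
  obtain s t where st: "0 \<le> s" "s \<le> h" "0 \<le> t" "t \<le> h"
    "F (p + h *\<^sub>R u + h *\<^sub>R v) - F (p + h *\<^sub>R u) - F (p + h *\<^sub>R v) + F p
      = h * h * A (p + s *\<^sub>R u + t *\<^sub>R v)"
    by (rule second_difference_mvt[OF F h inS(1)]) (assumption | rule that | simp add: A_def)+
  obtain s' t' where st': "0 \<le> s'" "s' \<le> h" "0 \<le> t'" "t' \<le> h"
    "F (p + h *\<^sub>R v + h *\<^sub>R u) - F (p + h *\<^sub>R v) - F (p + h *\<^sub>R u) + F p
      = h * h * B (p + t' *\<^sub>R v + s' *\<^sub>R u)"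
    by (rule second_difference_mvt[OF F h inS(2)]) (assumption | rule that | simp add: B_def)+
  have "F (p + h *\<^sub>R v + h *\<^sub>R u) = F (p + h *\<^sub>R u + h *\<^sub>R v)"
    "h * h * B (p + t' *\<^sub>R v + s' *\<^sub>R u) = h * h * B (p + s' *\<^sub>R u + t' *\<^sub>R v)"
    by (simp_all add: add_ac)
  then have "h * h * A (p + s *\<^sub>R u + t *\<^sub>R v) = h * h * B (p + s' *\<^sub>R u + t' *\<^sub>R v)"
    using st(5) st'(5) by linarith
  then have "A (p + s *\<^sub>R u + t *\<^sub>R v) = B (p + s' *\<^sub>R u + t' *\<^sub>R v)" using h by simp
  moreover have "dist (A (p + s *\<^sub>R u + t *\<^sub>R v)) (A p) < e"
    using near[OF st(1-4)] d12(3) by (auto simp: d_def)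
  moreover have "dist (B (p + s' *\<^sub>R u + t' *\<^sub>R v)) (B p) < e"
    using near[OF st'(1-4)] d12(4) by (auto simp: d_def)
  ultimately show False by (simp add: e_def dist_real_def abs_if split: if_splits)
qed

lemma frechet_derivative_linear:
  assumes "bounded_linear A" "f differentiable (at x)"
  shows "frechet_derivative (\<lambda>x. A (f x)) (at x) v = A (frechet_derivative f (at x) v)"
  by (intro frechet_derivative_eqI bounded_linear.has_derivative[OF assms(1)])
    (use assms(2) frechet_derivative_works in blast)

lemma smooth_on_differentiable: "smooth_on S f \<Longrightarrow> x \<in> S \<Longrightarrow> f differentiable (at x)"
  using smooth_on_has_derivative differentiable_def by blast

lemma frechet_derivative_symmetric:
  fixes F :: "'a::euclidean_space \<Rightarrow> 'b::euclidean_space"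
  assumes F: "smooth_on S F" and S: "open S" "p \<in> S"
  shows "frechet_derivative (\<lambda>q. frechet_derivative F (at q) u) (at p) v
    = frechet_derivative (\<lambda>q. frechet_derivative F (at q) v) (at p) u"
proof (rule euclidean_eqI)
  fix b :: 'b
  let ?A = "\<lambda>x::'b. x \<bullet> b"
  have bl: "bounded_linear ?A" by (rule bounded_linear_inner_left)
  have "frechet_derivative (\<lambda>q. frechet_derivative F (at q) u) (at p) v \<bullet> b
      = frechet_derivative (\<lambda>q. frechet_derivative (\<lambda>q. F q \<bullet> b) (at q) u) (at p) v" for u v
  proof -
    have "frechet_derivative (\<lambda>q. frechet_derivative F (at q) u) (at p) v \<bullet> b
      = frechet_derivative (\<lambda>q. frechet_derivative F (at q) u \<bullet> b) (at p) v"
      using frechet_derivative_linear[OF bl smooth_on_differentiable[OF smooth_on_frechet[OF F] S(2)]]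
      by simp
    \<comment> \<open>Pairing with \<open>b\<close> commutes with the inner derivative at points of
      \<open>S\<close> only, so the outer derivative is transferred through the open set.\<close>
    also have "\<dots> = frechet_derivative (\<lambda>q. frechet_derivative (\<lambda>q. F q \<bullet> b) (at q) u) (at p) v"
      by (rule fun_cong[OF frechet_derivative_transform_within_open[OF _ S]])
        (auto simp: frechet_derivative_linear[OF bl smooth_on_differentiable[OF F]]
          intro!: smooth_on_differentiable[OF _ S(2)] smooth_on_linear[OF S(1) bl] smooth_on_frechet F)
    finally show ?thesis .
  qed
  then show "frechet_derivative (\<lambda>q. frechet_derivative F (at q) u) (at p) v \<bullet> b
    = frechet_derivative (\<lambda>q. frechet_derivative F (at q) v) (at p) u \<bullet> b"
    using frechet_derivative_symmetric_real[OF smooth_on_linear[OF S(1) bl F] S] by simp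
qed

section \<open>Lie derivatives in coordinates\<close>

lemmas has_derivative_vec_nth [derivative_intros] =
  bounded_linear.has_derivative[OF bounded_linear_vec_nth]

lemma has_derivative_vec_componentwise:
  fixes f :: "'a::euclidean_space \<Rightarrow> real^'n"
  assumes "\<And>k. ((\<lambda>x. f x $ k) has_derivative (\<lambda>h. f' h $ k)) (at p)"
  shows "(f has_derivative f') (at p)"
  using assms by (subst has_derivative_componentwise_within) (auto simp: Basis_vec_def inner_axis)

text \<open>The direction varies with the point, while smoothness concerns fixed directions only.
  Expanding \<open>Y q\<close> in the basis gives a finite sum of scalar functions times
  fixed-direction derivatives, to which the product rule applies.\<close>

lemma has_derivative_frechet_apply:
  fixes Z :: "'a::euclidean_space \<Rightarrow> 'b::euclidean_space"
  assumes Z: "smooth_on M Z" and M: "open M" "p \<in> M" and Y: "(Y has_derivative Y') (at p)"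
  shows "((\<lambda>q. frechet_derivative Z (at q) (Y q)) has_derivative
     (\<lambda>h. frechet_derivative (\<lambda>q. frechet_derivative Z (at q) (Y p)) (at p) h
        + frechet_derivative Z (at p) (Y' h))) (at p)"
proof -
  have lin: "frechet_derivative Z (at q) y = (\<Sum>b\<in>Basis. (y \<bullet> b) *\<^sub>R frechet_derivative Z (at q) b)"
    if "q \<in> M" for q y
  proof -
    have l: "linear (frechet_derivative Z (at q))"
      by (rule has_derivative_linear[OF smooth_on_has_derivative[OF Z that]])
    have "frechet_derivative Z (at q) y = frechet_derivative Z (at q) (\<Sum>b\<in>Basis. (y \<bullet> b) *\<^sub>R b)"
      by (simp add: euclidean_representation)
    then show ?thesis by (simp add: linear_sum[OF l] linear_scale[OF l])
  qed
  define D where "D = (\<lambda>h b. frechet_derivative (\<lambda>q. frechet_derivative Z (at q) b) (at p) h)"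
  have Db: "((\<lambda>q. frechet_derivative Z (at q) b) has_derivative (\<lambda>h. D h b)) (at p)" for b
    unfolding D_def by (rule smooth_on_has_derivative[OF smooth_on_frechet[OF Z] M(2)])
  have gen: "((\<lambda>q. frechet_derivative Z (at q) (W q)) has_derivative
      (\<lambda>h. (\<Sum>b\<in>Basis. (W p \<bullet> b) *\<^sub>R D h b) + frechet_derivative Z (at p) (W' h))) (at p)"
    if W: "(W has_derivative W') (at p)" for W W'
  proof (rule has_derivative_transform_within_open[OF _ M])
    show "((\<lambda>q. \<Sum>b\<in>Basis. (W q \<bullet> b) *\<^sub>R frechet_derivative Z (at q) b) has_derivative
      (\<lambda>h. (\<Sum>b\<in>Basis. (W p \<bullet> b) *\<^sub>R D h b) + frechet_derivative Z (at p) (W' h))) (at p)"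
      unfolding lin[OF M(2), of "W' _"] sum.distrib[symmetric]
      by (intro has_derivative_sum has_derivative_scaleR has_derivative_inner_left W Db)
  qed (simp add: lin[symmetric])
  have "frechet_derivative Z (at p) 0 = 0"
    using lin[OF M(2), of 0] by simp
  with gen[OF has_derivative_const, of "Y p"]
  have "((\<lambda>q. frechet_derivative Z (at q) (Y p)) has_derivative (\<lambda>h. \<Sum>b\<in>Basis. (Y p \<bullet> b) *\<^sub>R D h b)) (at p)"
    by simp
  from frechet_derivative_eqI[OF this] gen[OF Y] show ?thesis by simp
qed

text \<open>The Christoffel symbols as a bilinear map at each point, so that the Lie derivative of
  the connection can be computed without indices.\<close>

definition christoffel_map :: "(real^'n \<Rightarrow> real^'n^'n) \<Rightarrow> real^'n \<Rightarrow> real^'n \<Rightarrow> real^'n \<Rightarrow> real^'n" where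
  "christoffel_map g p u v = (\<chi> k. \<Sum>i\<in>UNIV. \<Sum>j\<in>UNIV. christoffel g k i j p * u $ i * v $ j)"

lemma levi_civita_christoffel_map:
  "levi_civita g Y Z = (\<lambda>q. frechet_derivative Z (at q) (Y q) + christoffel_map g q (Y q) (Z q))"
  by (simp add: fun_eq_iff levi_civita_def christoffel_map_def)

lemma christoffel_map_diff_left:
  "christoffel_map g p (u - u') v = christoffel_map g p u v - christoffel_map g p u' v"
  by (simp add: christoffel_map_def vec_eq_iff sum_subtractf[symmetric] algebra_simps)

lemma christoffel_map_diff_right:
  "christoffel_map g p u (v - v') = christoffel_map g p u v - christoffel_map g p u v'"
  by (simp add: christoffel_map_def vec_eq_iff sum_subtractf[symmetric] algebra_simps)

definition christoffel_deriv ::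
  "(real^'n \<Rightarrow> real^'n^'n) \<Rightarrow> real^'n \<Rightarrow> real^'n \<Rightarrow> real^'n \<Rightarrow> real^'n \<Rightarrow> real^'n" where
  "christoffel_deriv g p h u v =
     (\<chi> k. \<Sum>i\<in>UNIV. \<Sum>j\<in>UNIV. frechet_derivative (christoffel g k i j) (at p) h * u $ i * v $ j)"

lemma has_derivative_christoffel_map:
  assumes g: "\<And>k i j. christoffel g k i j differentiable (at p)"
    and Y: "(Y has_derivative Y') (at p)" and Z: "(Z has_derivative Z') (at p)"
  shows "((\<lambda>q. christoffel_map g q (Y q) (Z q)) has_derivative
     (\<lambda>h. christoffel_deriv g p h (Y p) (Z p) + christoffel_map g p (Y' h) (Z p)
        + christoffel_map g p (Y p) (Z' h))) (at p)"
proof (rule has_derivative_vec_componentwise)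
  fix k
  have G: "(christoffel g k i j has_derivative frechet_derivative (christoffel g k i j) (at p)) (at p)" for i j
    using g frechet_derivative_works by blast
  have "((\<lambda>q. \<Sum>i\<in>UNIV. \<Sum>j\<in>UNIV. christoffel g k i j q * Y q $ i * Z q $ j) has_derivative
     (\<lambda>h. \<Sum>i\<in>UNIV. \<Sum>j\<in>UNIV. christoffel g k i j p * Y p $ i * Z' h $ j
       + (christoffel g k i j p * Y' h $ i + frechet_derivative (christoffel g k i j) (at p) h * Y p $ i) * Z p $ j))
     (at p)"
    by (intro has_derivative_sum has_derivative_mult has_derivative_vec_nth G Y Z)
  then show "((\<lambda>q. christoffel_map g q (Y q) (Z q) $ k) has_derivative
     (\<lambda>h. (christoffel_deriv g p h (Y p) (Z p) + christoffel_map g p (Y' h) (Z p)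
        + christoffel_map g p (Y p) (Z' h)) $ k)) (at p)"
    by (simp add: christoffel_map_def christoffel_deriv_def sum.distrib[symmetric] algebra_simps)
qed

text \<open>Tensoriality of the Lie derivative of the connection: all derivatives of
  \<open>Y\<close> and \<open>Z\<close> cancel. What is left is the classical expression in the
  Hessian of \<open>X\<close>, the derivative of the Christoffel symbols along \<open>X\<close>, and
  three terms linear in the first derivatives of \<open>X\<close>.\<close>

lemma lie_connection_eq:
  fixes X Y Z :: "real^'n \<Rightarrow> real^'n"
  assumes X: "smooth_on M X" and Y: "smooth_on M Y" and Z: "smooth_on M Z"
    and M: "open M" "p \<in> M"
    and g: "\<And>k i j. christoffel g k i j differentiable (at p)"
  shows "lie_connection (levi_civita g) X Y Z p =
      frechet_derivative (\<lambda>q. frechet_derivative X (at q) (Z p)) (at p) (Y p)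
      + christoffel_deriv g p (X p) (Y p) (Z p)
      - frechet_derivative X (at p) (christoffel_map g p (Y p) (Z p))
      + christoffel_map g p (frechet_derivative X (at p) (Y p)) (Z p)
      + christoffel_map g p (Y p) (frechet_derivative X (at p) (Z p))"
proof -
  note D = smooth_on_has_derivative[OF _ M(2)]
  let ?DX = "frechet_derivative X (at p)" and ?DY = "frechet_derivative Y (at p)"
    and ?DZ = "frechet_derivative Z (at p)"
  let ?\<Gamma> = "christoffel_map g p"
  have lin: "linear ?DX" "linear ?DZ"
    using has_derivative_linear D X Z by blast+
  have "frechet_derivative (levi_civita g Y Z) (at p) (X p)
      = frechet_derivative (\<lambda>q. frechet_derivative Z (at q) (Y p)) (at p) (X p) + ?DZ (?DY (X p))
        + (christoffel_deriv g p (X p) (Y p) (Z p) + ?\<Gamma> (?DY (X p)) (Z p) + ?\<Gamma> (Y p) (?DZ (X p)))"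
    unfolding levi_civita_christoffel_map
    by (rule frechet_derivative_eqI)
      (intro has_derivative_add has_derivative_frechet_apply[OF Z M D[OF Y]]
        has_derivative_christoffel_map[OF g D[OF Y] D[OF Z]])
  moreover have "frechet_derivative (lie_bracket X Z) (at p) (Y p)
      = (frechet_derivative (\<lambda>q. frechet_derivative Z (at q) (X p)) (at p) (Y p) + ?DZ (?DX (Y p)))
       - (frechet_derivative (\<lambda>q. frechet_derivative X (at q) (Z p)) (at p) (Y p) + ?DX (?DZ (Y p)))"
    unfolding lie_bracket_def
    by (rule frechet_derivative_eqI)
      (intro has_derivative_diff has_derivative_frechet_apply[OF Z M D[OF X]]
        has_derivative_frechet_apply[OF X M D[OF Z]])
  \<comment> \<open>The second derivatives of \<open>Z\<close> enter once with directions
    (\<open>Y\<close>, \<open>X\<close>) and once with (\<open>X\<close>, \<open>Y\<close>);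
    symmetry makes them cancel.\<close>
  moreover have "frechet_derivative (\<lambda>q. frechet_derivative Z (at q) (Y p)) (at p) (X p)
      = frechet_derivative (\<lambda>q. frechet_derivative Z (at q) (X p)) (at p) (Y p)"
    by (rule frechet_derivative_symmetric[OF Z M])
  ultimately show ?thesis
    unfolding lie_connection_def lie_bracket_def[of X "levi_civita g Y Z"]
      levi_civita_christoffel_map[of g "lie_bracket X Y"] levi_civita_christoffel_map[of g Y "lie_bracket X Z"]
    by (simp add: levi_civita_christoffel_map lie_bracket_def linear_diff[OF lin(1)] linear_diff[OF lin(2)]
        linear_add[OF lin(1)] christoffel_map_diff_left christoffel_map_diff_right algebra_simps)
qed

section \<open>Partial derivatives on a coordinate box\<close>

lemma open_coord_box: "open T \<Longrightarrow> open I \<Longrightarrow> open J \<Longrightarrow> open (coord_box T I J)"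
  unfolding coord_box_def
  by (intro open_Collect_conj)
    (auto intro!: open_vimage[of _ "\<lambda>p. p $ _", unfolded vimage_def] continuous_intros)

lemma convex_coord_box: "convex T \<Longrightarrow> convex I \<Longrightarrow> convex J \<Longrightarrow> convex (coord_box T I J)"
  by (simp add: coord_box_def convex_def)

lemma vec3_expand: "(v::real^3) = v $ 1 *\<^sub>R axis 1 1 + v $ 2 *\<^sub>R axis 2 1 + v $ 3 *\<^sub>R axis 3 1"
  by (simp add: vec_eq_iff forall_3 axis_def)

lemma vector_collapse3: "vector [p $ 1, p $ 2, p $ 3] = (p::real^3)"
  by (simp add: vec_eq_iff forall_3)

lemma frechet_derivative_partial:
  fixes h :: "real^3 \<Rightarrow> real"
  assumes "h differentiable (at p)"
  shows "frechet_derivative h (at p) v = v $ 1 * partial 1 h p + v $ 2 * partial 2 h p + v $ 3 * partial 3 h p"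
proof -
  note l = linear_frechet_derivative[OF assms]
  show ?thesis
    by (subst vec3_expand[of v], unfold linear_add[OF l] linear_scale[OF l]) (simp add: partial_def)
qed

lemma frechet_derivative_component:
  fixes X :: "real^3 \<Rightarrow> real^3"
  assumes "X differentiable (at p)"
  shows "frechet_derivative X (at p) v $ k = v $ 1 * partial 1 (\<lambda>q. X q $ k) p
    + v $ 2 * partial 2 (\<lambda>q. X q $ k) p + v $ 3 * partial 3 (\<lambda>q. X q $ k) p"
proof -
  have "(\<lambda>q. X q $ k) differentiable (at p)"
    using assms has_derivative_vec_nth unfolding differentiable_def by blast
  from frechet_derivative_partial[OF this]
  show ?thesis using frechet_derivative_linear[OF bounded_linear_vec_nth assms] by metis
qed

lemma smooth_on_component: "open S \<Longrightarrow> smooth_on S X \<Longrightarrow> smooth_on S (\<lambda>p. X p $ k)"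
  by (rule smooth_on_linear[OF _ bounded_linear_vec_nth])

lemma smooth_on_ident: "smooth_on S (\<lambda>p. p)"
  unfolding smooth_on_def
proof
  show "Ck_on n S (\<lambda>p. p)" for n by (cases n) (simp_all add: Ck_on_const)
qed

lemma smooth_on_coord: "open S \<Longrightarrow> smooth_on S (\<lambda>p. p $ k)"
  by (rule smooth_on_linear[OF _ bounded_linear_vec_nth smooth_on_ident])

lemma smooth_on_partial: "smooth_on S h \<Longrightarrow> smooth_on S (partial i h)"
  unfolding partial_def[abs_def] by (rule smooth_on_frechet)

lemma partial_cong:
  fixes h k :: "real^'n \<Rightarrow> real"
  assumes "open S" "p \<in> S" "smooth_on S h" "\<And>q. q \<in> S \<Longrightarrow> h q = k q"
  shows "partial i h p = partial i k p"
  unfolding partial_def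
  using frechet_derivative_transform_within_open[OF smooth_on_differentiable[OF assms(3,2)] assms(1,2,4)]
  by simp

lemma partial_const [simp]: "partial i (\<lambda>q. c) p = 0"
  by (simp add: partial_def)

lemma partial_coord [simp]: "partial i (\<lambda>q. q $ j) p = (if i = j then 1 else 0)"
  unfolding partial_def
  by (subst frechet_derivative_eqI[OF bounded_linear_imp_has_derivative[OF bounded_linear_vec_nth]])
    (simp add: axis_def)

lemma partial_add:
  "smooth_on S h \<Longrightarrow> smooth_on S k \<Longrightarrow> p \<in> S \<Longrightarrow> partial i (\<lambda>q. h q + k q) p = partial i h p + partial i k p"
  unfolding partial_def by (intro frechet_derivative_eqI has_derivative_add smooth_on_has_derivative)

lemma partial_diff:
  "smooth_on S h \<Longrightarrow> smooth_on S k \<Longrightarrow> p \<in> S \<Longrightarrow> partial i (\<lambda>q. h q - k q) p = partial i h p - partial i k p"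
  unfolding partial_def by (intro frechet_derivative_eqI has_derivative_diff smooth_on_has_derivative)

lemma partial_mult:
  "smooth_on S h \<Longrightarrow> smooth_on S k \<Longrightarrow> p \<in> S
    \<Longrightarrow> partial i (\<lambda>q. h q * k q) p = h p * partial i k p + partial i h p * k p"
  unfolding partial_def by (intro frechet_derivative_eqI has_derivative_mult smooth_on_has_derivative)

lemma partial_commute:
  assumes "smooth_on S h" "open S" "p \<in> S"
  shows "partial i (partial j h) p = partial j (partial i h) p"
  unfolding partial_def[abs_def] by (rule frechet_derivative_symmetric[OF assms])

text \<open>Along the segment from \<open>p\<close> to \<open>q\<close> the derivative of
  \<open>h\<close> is the sum of its partials weighted by the coordinate differences, so only the
  coordinates that change contribute. This serves both for constancy on the whole box and for moving
  a point with its y-coordinate fixed.\<close>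

lemma partial_zero_imp_eq:
  fixes h :: "real^3 \<Rightarrow> real"
  assumes h: "smooth_on S h" and S: "convex S" "p \<in> S" "q \<in> S"
    and zero: "\<And>i r. r \<in> S \<Longrightarrow> p $ i \<noteq> q $ i \<Longrightarrow> partial i h r = 0"
  shows "h p = h q"
proof -
  have der: "((\<lambda>s. h (p + s *\<^sub>R (q - p))) has_derivative (\<lambda>r. 0)) (at s)" if "0 \<le> s" "s \<le> 1" for s
  proof -
    have S': "p + s *\<^sub>R (q - p) \<in> S"
      using convexD_alt[OF S that] by (simp add: algebra_simps)
    have "((\<lambda>s. p + s *\<^sub>R (q - p)) has_derivative (\<lambda>r. r *\<^sub>R (q - p))) (at s)"
      by (rule derivative_eq_intros refl | simp)+
    from has_derivative_compose[OF this smooth_on_has_derivative[OF h S']]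
    have "((\<lambda>s. h (p + s *\<^sub>R (q - p))) has_derivative
      (\<lambda>r. frechet_derivative h (at (p + s *\<^sub>R (q - p))) (r *\<^sub>R (q - p)))) (at s)" .
    moreover have "frechet_derivative h (at (p + s *\<^sub>R (q - p))) (r *\<^sub>R (q - p)) = 0" for r
      unfolding frechet_derivative_partial[OF smooth_on_differentiable[OF h S']]
      using zero[OF S', of 1] zero[OF S', of 2] zero[OF S', of 3]
      by (cases "p $ 1 = q $ 1"; cases "p $ 2 = q $ 2"; cases "p $ 3 = q $ 3") simp_all
    ultimately show ?thesis by simp
  qed
  have "((\<lambda>s. h (p + s *\<^sub>R (q - p))) has_derivative (\<lambda>r. 0)) (at s within {0..1})"
    if "0 \<le> s" "s \<le> 1" for s
    using der[OF that] by (rule has_derivative_at_withinI)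
  from mvt_simple[OF zero_less_one this]
  have "h (p + 1 *\<^sub>R (q - p)) - h (p + 0 *\<^sub>R (q - p)) = 0" by blast
  then show ?thesis by simp
qed

section \<open>The Walker metric\<close>

text \<open>\<open>matrix_inv\<close> is a Hilbert choice; uniqueness of two-sided inverses pins it
  down.\<close>

lemma matrix_inv_eqI:
  fixes A :: "'a::semiring_1^'n^'n"
  assumes "A ** B = mat 1" "B ** A = mat 1"
  shows "matrix_inv A = B"
  unfolding matrix_inv_def
proof (rule some_equality)
  fix C assume "A ** C = mat 1 \<and> C ** A = mat 1"
  then show "C = B"
    using assms matrix_mul_assoc[of C A B] by simp
qed (use assms in simp)

lemma matrix_inv_walker_metric:
  "matrix_inv (walker_metric f p)
    = vector [vector [- f (p $ 2) (p $ 3), 0, 1], vector [0, 1, 0], vector [1, 0, 0]]"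
  by (rule matrix_inv_eqI)
    (simp_all add: vec_eq_iff forall_3 walker_metric_def matrix_matrix_mult_def sum_3 mat_def)

lemma metric_app_walker:
  "metric_app (walker_metric f) Y Z p
    = Y p $ 1 * Z p $ 3 + Y p $ 3 * Z p $ 1 + Y p $ 2 * Z p $ 2 + f (p $ 2) (p $ 3) * (Y p $ 3 * Z p $ 3)"
  by (simp add: metric_app_def walker_metric_def sum_3)

locale walker_box =
  fixes f :: "real \<Rightarrow> real \<Rightarrow> real" and T I J :: "real set"
  assumes T: "open_interval T" and I: "open_interval I" and J: "open_interval J"
    and f_smooth: "smooth_on (I \<times> J) (\<lambda>(x, y). f x y)"
begin

abbreviation "M \<equiv> coord_box T I J"
abbreviation "g \<equiv> walker_metric f"

text \<open>The pullback of \<open>f\<close> to the box: the analysis uses \<open>partial\<close> on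
  one space and returns to \<open>dx\<close> and \<open>dy\<close> only when the final equation is
  read off.\<close>

definition F :: "real^3 \<Rightarrow> real" where "F p = f (p $ 2) (p $ 3)"

abbreviation "Fx \<equiv> partial 2 F"
abbreviation "Fy \<equiv> partial 3 F"

lemma open_M: "open M" and convex_M: "convex M"
  using T I J by (auto simp: open_interval_def is_interval_convex intro: open_coord_box convex_coord_box)

lemma smooth_F: "smooth_on M F"
proof -
  have "smooth_on M (\<lambda>p::real^3. (\<lambda>(x, y). f x y) (0 + (p $ 2, p $ 3)))"
    by (rule smooth_on_affine_compose[OF open_M _ _ f_smooth])
      (auto simp: coord_box_def zero_prod_def intro!: bounded_linear_Pair bounded_linear_vec_nth)
  then show ?thesis by (simp add: F_def[abs_def] zero_prod_def)
qed

lemmas smooth_intros =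
  smooth_F smooth_on_partial smooth_on_const smooth_on_add[OF open_M] smooth_on_diff[OF open_M]
  smooth_on_mult[OF open_M] smooth_on_coord[OF open_M] smooth_on_component[OF open_M]

lemmas partial_simps = partial_add[where S = M] partial_diff[where S = M] partial_mult[where S = M]

lemma partial_commutes:
  assumes "smooth_on M h" "p \<in> M"
  shows "partial 2 (partial 1 h) p = partial 1 (partial 2 h) p"
    "partial 3 (partial 1 h) p = partial 1 (partial 3 h) p"
    "partial 3 (partial 2 h) p = partial 2 (partial 3 h) p"
  using partial_commute[OF assms(1) open_M assms(2)] by blast+

lemma partial_eq:
  assumes "\<And>q. q \<in> M \<Longrightarrow> h q = k q" "smooth_on M h" "p \<in> M"
  shows "partial i h p = partial i k p"
  by (rule partial_cong[OF open_M assms(3,2,1)])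

lemma partial_F_t: "p \<in> M \<Longrightarrow> partial 1 F p = 0"
proof -
  assume p: "p \<in> M"
  have d: "(F has_derivative frechet_derivative F (at p)) (at p)"
    by (rule smooth_on_has_derivative[OF smooth_F p])
  have "((\<lambda>s::real. p + s *\<^sub>R axis 1 1) has_derivative (\<lambda>r. r *\<^sub>R axis 1 1)) (at 0)"
    by (rule derivative_eq_intros refl | simp)+
  from has_derivative_compose[OF this, of F] d
  have "((\<lambda>s. F (p + s *\<^sub>R axis 1 1)) has_derivative (\<lambda>r. frechet_derivative F (at p) (r *\<^sub>R axis 1 1))) (at 0)"
    by simp
  moreover have "(\<lambda>s. F (p + s *\<^sub>R axis 1 1)) = (\<lambda>s. F p)"
    by (simp add: F_def axis_def fun_eq_iff)
  ultimately have "((\<lambda>s::real. F p) has_derivative (\<lambda>r. frechet_derivative F (at p) (r *\<^sub>R axis 1 1))) (at 0)"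
    by simp
  from has_derivative_unique[OF this has_derivative_const]
  have "frechet_derivative F (at p) (1 *\<^sub>R axis 1 1) = 0" by metis
  then show ?thesis by (simp add: partial_def)
qed

lemma partial_t_partial_F:
  assumes p: "p \<in> M"
  shows "partial 1 (partial i F) p = 0"
proof -
  have "partial i (partial 1 F) p = partial i (\<lambda>q. 0) p"
    by (rule partial_eq[OF partial_F_t smooth_on_partial[OF smooth_F] p])
  then show ?thesis using partial_commute[OF smooth_F open_M p, of 1 i] by simp
qed

lemma frechet_derivative_F:
  "p \<in> M \<Longrightarrow> frechet_derivative F (at p) v = v $ 2 * Fx p + v $ 3 * Fy p"
  using frechet_derivative_partial[OF smooth_on_differentiable[OF smooth_F]] partial_F_t by simp

text \<open>The derivatives of \<open>Y\<close> and \<open>Z\<close> from the product rule cancel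
  those in the brackets, which leaves the derivative of the Gram matrix along \<open>X\<close> and
  two terms in the derivative of \<open>X\<close>.\<close>

lemma lie_metric_walker:
  assumes X: "smooth_on M X" and Y: "smooth_on M Y" and Z: "smooth_on M Z" and p: "p \<in> M"
  shows "lie_metric g X Y Z p =
    (X p $ 2 * Fx p + X p $ 3 * Fy p) * (Y p $ 3 * Z p $ 3)
    + metric_app g (\<lambda>q. frechet_derivative X (at q) (Y q)) Z p
    + metric_app g Y (\<lambda>q. frechet_derivative X (at q) (Z q)) p"
proof -
  note D = smooth_on_has_derivative[OF _ p]
  have "((\<lambda>q. Y q $ 1 * Z q $ 3 + Y q $ 3 * Z q $ 1 + Y q $ 2 * Z q $ 2 + F q * (Y q $ 3 * Z q $ 3))
    has_derivative (\<lambda>h. Y p $ 1 * frechet_derivative Z (at p) h $ 3 + frechet_derivative Y (at p) h $ 1 * Z p $ 3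
     + (Y p $ 3 * frechet_derivative Z (at p) h $ 1 + frechet_derivative Y (at p) h $ 3 * Z p $ 1)
     + (Y p $ 2 * frechet_derivative Z (at p) h $ 2 + frechet_derivative Y (at p) h $ 2 * Z p $ 2)
     + (F p * (Y p $ 3 * frechet_derivative Z (at p) h $ 3 + frechet_derivative Y (at p) h $ 3 * Z p $ 3)
       + frechet_derivative F (at p) h * (Y p $ 3 * Z p $ 3)))) (at p)"
    by (intro has_derivative_add has_derivative_mult has_derivative_vec_nth D X Y Z smooth_F)
  from frechet_derivative_eqI[OF this, of "X p"]
  show ?thesis
    unfolding lie_metric_def vf_apply_def metric_app_walker[abs_def] lie_bracket_def
    by (simp add: F_def[symmetric] frechet_derivative_F[OF p] algebra_simps)
qed

lemma partial_walker_metric: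
  "partial i (\<lambda>q. walker_metric f q $ j $ l) p = (if j = 3 \<and> l = 3 then partial i F p else 0)"
proof -
  have "(\<lambda>q. walker_metric f q $ j $ l) =
    (if j = 3 \<and> l = 3 then F else (\<lambda>q. if j = 1 \<and> l = 3 \<or> j = 2 \<and> l = 2 \<or> j = 3 \<and> l = 1 then 1 else 0))"
    using exhaust_3[of j] exhaust_3[of l] by (auto simp: walker_metric_def F_def fun_eq_iff)
  then show ?thesis by simp
qed

lemma christoffel_walker:
  assumes "p \<in> M"
  shows "christoffel g k i j p =
    (if k = 1 then (if i = 2 \<and> j = 3 \<or> i = 3 \<and> j = 2 then Fx p / 2 else if i = 3 \<and> j = 3 then Fy p / 2 else 0)
     else if k = 2 \<and> i = 3 \<and> j = 3 then - Fx p / 2 else 0)"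
  using exhaust_3[of k] exhaust_3[of i] exhaust_3[of j] partial_F_t[OF assms]
  unfolding christoffel_def partial_walker_metric matrix_inv_walker_metric sum_3
  by (elim disjE) (simp_all add: field_simps)

lemma has_derivative_christoffel:
  assumes p: "p \<in> M"
  shows "(christoffel g k i j has_derivative (\<lambda>v.
    (if k = 1 then (if i = 2 \<and> j = 3 \<or> i = 3 \<and> j = 2 then frechet_derivative Fx (at p) v / 2
        else if i = 3 \<and> j = 3 then frechet_derivative Fy (at p) v / 2 else 0)
     else if k = 2 \<and> i = 3 \<and> j = 3 then - frechet_derivative Fx (at p) v / 2 else 0))) (at p)"
proof (rule has_derivative_transform_within_open[OF _ open_M p christoffel_walker[symmetric]])
  note d [derivative_intros] = smooth_on_has_derivative[OF smooth_on_partial[OF smooth_F] p]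
  show "((\<lambda>p. if k = 1 then (if i = 2 \<and> j = 3 \<or> i = 3 \<and> j = 2 then Fx p / 2 else if i = 3 \<and> j = 3 then Fy p / 2 else 0)
     else if k = 2 \<and> i = 3 \<and> j = 3 then - Fx p / 2 else 0) has_derivative (\<lambda>v.
    (if k = 1 then (if i = 2 \<and> j = 3 \<or> i = 3 \<and> j = 2 then frechet_derivative Fx (at p) v / 2
        else if i = 3 \<and> j = 3 then frechet_derivative Fy (at p) v / 2 else 0)
     else if k = 2 \<and> i = 3 \<and> j = 3 then - frechet_derivative Fx (at p) v / 2 else 0))) (at p)"
    by (cases "k = 1"; cases "i = 2 \<and> j = 3 \<or> i = 3 \<and> j = 2"; cases "i = 3 \<and> j = 3"; cases "k = 2")
      (auto intro!: derivative_eq_intros)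
qed

lemma christoffel_map_walker:
  assumes "p \<in> M"
  shows "christoffel_map g p u v =
    vector [(Fx p * (u $ 2 * v $ 3 + u $ 3 * v $ 2) + Fy p * (u $ 3 * v $ 3)) / 2, - Fx p * (u $ 3 * v $ 3) / 2, 0]"
  by (simp add: vec_eq_iff forall_3 christoffel_map_def sum_3 christoffel_walker[OF assms] field_simps)

lemma christoffel_deriv_walker:
  assumes "p \<in> M"
  shows "christoffel_deriv g p h u v =
    vector [(frechet_derivative Fx (at p) h * (u $ 2 * v $ 3 + u $ 3 * v $ 2)
       + frechet_derivative Fy (at p) h * (u $ 3 * v $ 3)) / 2,
     - frechet_derivative Fx (at p) h * (u $ 3 * v $ 3) / 2, 0]"
  unfolding christoffel_deriv_def frechet_derivative_eqI[OF has_derivative_christoffel[OF assms]]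
  by (simp add: vec_eq_iff forall_3 sum_3 field_simps)

end

section \<open>The homothetic and affine conditions as systems of partial differential
  equations\<close>

locale walker_field = walker_box f T I J for f T I J +
  fixes X :: "real^3 \<Rightarrow> real^3"
  assumes X: "smooth_on (coord_box T I J) X"
begin

abbreviation "u \<equiv> \<lambda>p. X p $ 1"
abbreviation "v \<equiv> \<lambda>p. X p $ 2"
abbreviation "w \<equiv> \<lambda>p. X p $ 3"

lemma smooth_uvw: "smooth_on M u" "smooth_on M v" "smooth_on M w"
  using X by (auto intro: smooth_intros)

text \<open>The tt, tx, ty, xx, xy and yy components, in this order, with tt halved; they match the
  coefficients of the bilinear form below.\<close>

definition homothetic_eqs :: "real \<Rightarrow> real^3 \<Rightarrow> bool" where
  "homothetic_eqs \<eta> p \<longleftrightarrow>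
     partial 1 w p = 0 \<and> partial 2 w p + partial 1 v p = 0
     \<and> partial 3 w p + partial 1 u p + F p * partial 1 w p - \<eta> = 0
     \<and> 2 * partial 2 v p - \<eta> = 0
     \<and> partial 3 v p + partial 2 u p + F p * partial 2 w p = 0
     \<and> v p * Fx p + w p * Fy p + 2 * (partial 3 u p + F p * partial 3 w p) - \<eta> * F p = 0"

text \<open>Grouping by symmetrized products isolates the components: a pair of constant frame
  fields picks out one coefficient, and vanishing coefficients give the condition for all fields.
  Both directions of \<open>homothetic_const_iff\<close> rest on this.\<close>

lemma lie_metric_quadratic_form:
  assumes Y: "smooth_on M Y" and Z: "smooth_on M Z" and p: "p \<in> M"
  shows "lie_metric g X Y Z p - \<eta> * metric_app g Y Z p =
     2 * partial 1 w p * (Y p $ 1 * Z p $ 1)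
     + (partial 2 w p + partial 1 v p) * (Y p $ 1 * Z p $ 2 + Y p $ 2 * Z p $ 1)
     + (partial 3 w p + partial 1 u p + F p * partial 1 w p - \<eta>) * (Y p $ 1 * Z p $ 3 + Y p $ 3 * Z p $ 1)
     + (2 * partial 2 v p - \<eta>) * (Y p $ 2 * Z p $ 2)
     + (partial 3 v p + partial 2 u p + F p * partial 2 w p) * (Y p $ 2 * Z p $ 3 + Y p $ 3 * Z p $ 2)
     + (v p * Fx p + w p * Fy p + 2 * (partial 3 u p + F p * partial 3 w p) - \<eta> * F p) * (Y p $ 3 * Z p $ 3)"
  unfolding lie_metric_walker[OF X Y Z p] metric_app_walker F_def[symmetric]
    frechet_derivative_component[OF smooth_on_differentiable[OF X p]]
  by algebra

lemma homothetic_const_iff: "homothetic_const_on M g \<eta> X \<longleftrightarrow> (\<forall>p\<in>M. homothetic_eqs \<eta> p)"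
proof
  assume hom: "homothetic_const_on M g \<eta> X"
  show "\<forall>p\<in>M. homothetic_eqs \<eta> p"
  proof
    fix p assume p: "p \<in> M"
    have "lie_metric g X (\<lambda>_. axis i 1) (\<lambda>_. axis j 1) p
        - \<eta> * metric_app g (\<lambda>_. axis i 1) (\<lambda>_. axis j 1) p = 0" for i j
      using hom p smooth_on_const[of M] unfolding homothetic_const_on_def by auto
    then have q: "0 = lie_metric g X (\<lambda>_. axis i 1) (\<lambda>_. axis j 1) p
        - \<eta> * metric_app g (\<lambda>_. axis i 1) (\<lambda>_. axis j 1) p" for i j
      by simp
    note q = q[unfolded lie_metric_quadratic_form[OF smooth_on_const smooth_on_const p]]
    show "homothetic_eqs \<eta> p"
      using q[of 1 1] q[of 1 2] q[of 1 3] q[of 2 2] q[of 2 3] q[of 3 3]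
      unfolding homothetic_eqs_def by (simp add: axis_def)
  qed
next
  assume eqs: "\<forall>p\<in>M. homothetic_eqs \<eta> p"
  show "homothetic_const_on M g \<eta> X"
    unfolding homothetic_const_on_def
  proof (intro allI impI ballI)
    fix Y Z :: "real^3 \<Rightarrow> real^3" and p assume YZ: "smooth_on M Y" "smooth_on M Z" and p: "p \<in> M"
    from eqs p have "homothetic_eqs \<eta> p" by blast
    then have "lie_metric g X Y Z p - \<eta> * metric_app g Y Z p = 0"
      unfolding lie_metric_quadratic_form[OF YZ p] homothetic_eqs_def by (elim conjE) (simp only: mult_zero_left mult_zero_right add_0)
    then show "lie_metric g X Y Z p = \<eta> * metric_app g Y Z p" by simp
  qed
qed

text \<open>Commuting mixed partials into one fixed order leaves six second derivatives per
  component instead of nine, already grouped symmetrically in \<open>y\<close> and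
  \<open>z\<close>.\<close>

lemma second_derivative_component:
  assumes p: "p \<in> M"
  shows "frechet_derivative (\<lambda>q. frechet_derivative X (at q) z) (at p) y $ k =
    y $ 1 * z $ 1 * partial 1 (partial 1 (\<lambda>q. X q $ k)) p
    + (y $ 1 * z $ 2 + y $ 2 * z $ 1) * partial 1 (partial 2 (\<lambda>q. X q $ k)) p
    + (y $ 1 * z $ 3 + y $ 3 * z $ 1) * partial 1 (partial 3 (\<lambda>q. X q $ k)) p
    + y $ 2 * z $ 2 * partial 2 (partial 2 (\<lambda>q. X q $ k)) p
    + (y $ 2 * z $ 3 + y $ 3 * z $ 2) * partial 2 (partial 3 (\<lambda>q. X q $ k)) p
    + y $ 3 * z $ 3 * partial 3 (partial 3 (\<lambda>q. X q $ k)) p"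
proof -
  have sk: "smooth_on M (\<lambda>q. X q $ k)" by (intro smooth_intros X)
  note s = smooth_on_partial[OF sk]
  have H: "smooth_on M (\<lambda>q. frechet_derivative X (at q) z)" by (rule smooth_on_frechet[OF X])
  have part: "partial i (\<lambda>q. frechet_derivative X (at q) z $ k) p
      = z $ 1 * partial i (partial 1 (\<lambda>q. X q $ k)) p + z $ 2 * partial i (partial 2 (\<lambda>q. X q $ k)) p
        + z $ 3 * partial i (partial 3 (\<lambda>q. X q $ k)) p" for i
  proof -
    have "partial i (\<lambda>q. frechet_derivative X (at q) z $ k) p
      = partial i (\<lambda>q. z $ 1 * partial 1 (\<lambda>q. X q $ k) q + z $ 2 * partial 2 (\<lambda>q. X q $ k) q
          + z $ 3 * partial 3 (\<lambda>q. X q $ k) q) p"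
      by (rule partial_eq[OF _ _ p])
        (use frechet_derivative_component[OF smooth_on_differentiable[OF X]] H
          in \<open>auto intro: smooth_on_component[OF open_M]\<close>)
    also have "\<dots> = z $ 1 * partial i (partial 1 (\<lambda>q. X q $ k)) p + z $ 2 * partial i (partial 2 (\<lambda>q. X q $ k)) p
        + z $ 3 * partial i (partial 3 (\<lambda>q. X q $ k)) p"
      by (simp add: partial_simps smooth_intros s p)
    finally show ?thesis .
  qed
  show ?thesis
    unfolding frechet_derivative_component[OF smooth_on_differentiable[OF H p]] part partial_commutes[OF sk p]
    by algebra
qed

text \<open>Three blocks of six, for the y-, x- and t-components, each ordered tt, tx, ty, xx, xy,
  yy. In this order the system is triangular: the first block involves only \<open>w\<close> and the
  second only \<open>v\<close> and \<open>w\<close>.\<close>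

definition affine_eqs :: "real^3 \<Rightarrow> bool" where
  "affine_eqs p \<longleftrightarrow>
     partial 1 (partial 1 w) p = 0 \<and> partial 1 (partial 2 w) p = 0 \<and> partial 1 (partial 3 w) p = 0
     \<and> partial 2 (partial 2 w) p = 0
     \<and> partial 2 (partial 3 w) p - Fx p * partial 1 w p / 2 = 0
     \<and> partial 3 (partial 3 w) p - Fy p * partial 1 w p / 2 + Fx p * partial 2 w p / 2 = 0
     \<and> partial 1 (partial 1 v) p = 0 \<and> partial 1 (partial 2 v) p = 0
     \<and> partial 1 (partial 3 v) p - Fx p * partial 1 w p / 2 = 0
     \<and> partial 2 (partial 2 v) p = 0
     \<and> partial 2 (partial 3 v) p - Fx p * partial 1 v p / 2 - Fx p * partial 2 w p / 2 = 0
     \<and> partial 3 (partial 3 v) p - (v p * partial 2 Fx p + w p * partial 2 Fy p) / 2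
         - Fy p * partial 1 v p / 2 + Fx p * partial 2 v p / 2 - Fx p * partial 3 w p = 0
     \<and> partial 1 (partial 1 u) p = 0
     \<and> partial 1 (partial 2 u) p + Fx p * partial 1 w p / 2 = 0
     \<and> partial 1 (partial 3 u) p + Fx p * partial 1 v p / 2 + Fy p * partial 1 w p / 2 = 0
     \<and> partial 2 (partial 2 u) p + Fx p * partial 2 w p = 0
     \<and> partial 2 (partial 3 u) p + (v p * partial 2 Fx p + w p * partial 2 Fy p) / 2
         - Fx p * partial 1 u p / 2 + Fx p * partial 2 v p / 2 + Fy p * partial 2 w p / 2
         + Fx p * partial 3 w p / 2 = 0
     \<and> partial 3 (partial 3 u) p + (v p * partial 2 Fy p + w p * partial 3 Fy p) / 2
         - Fy p * partial 1 u p / 2 + Fx p * partial 2 u p / 2 + Fx p * partial 3 v p + Fy p * partial 3 w p = 0"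

text \<open>The Hessian and the Christoffel symbols are symmetric in their lower indices, so six
  coefficients per component suffice, and constant frame fields again isolate them.\<close>

lemma lie_connection_quadratic_form:
  assumes Y: "smooth_on M Y" and Z: "smooth_on M Z" and p: "p \<in> M"
  defines "y \<equiv> Y p" and "z \<equiv> Z p"
  shows "lie_connection (levi_civita g) X Y Z p $ 1 =
      partial 1 (partial 1 u) p * (y $ 1 * z $ 1)
      + (partial 1 (partial 2 u) p + Fx p * partial 1 w p / 2) * (y $ 1 * z $ 2 + y $ 2 * z $ 1)
      + (partial 1 (partial 3 u) p + Fx p * partial 1 v p / 2 + Fy p * partial 1 w p / 2)
        * (y $ 1 * z $ 3 + y $ 3 * z $ 1)
      + (partial 2 (partial 2 u) p + Fx p * partial 2 w p) * (y $ 2 * z $ 2)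
      + (partial 2 (partial 3 u) p + (v p * partial 2 Fx p + w p * partial 2 Fy p) / 2
         - Fx p * partial 1 u p / 2 + Fx p * partial 2 v p / 2 + Fy p * partial 2 w p / 2
         + Fx p * partial 3 w p / 2) * (y $ 2 * z $ 3 + y $ 3 * z $ 2)
      + (partial 3 (partial 3 u) p + (v p * partial 2 Fy p + w p * partial 3 Fy p) / 2
         - Fy p * partial 1 u p / 2 + Fx p * partial 2 u p / 2 + Fx p * partial 3 v p + Fy p * partial 3 w p)
        * (y $ 3 * z $ 3)" (is ?thesis1)
    and "lie_connection (levi_civita g) X Y Z p $ 2 =
      partial 1 (partial 1 v) p * (y $ 1 * z $ 1)
      + partial 1 (partial 2 v) p * (y $ 1 * z $ 2 + y $ 2 * z $ 1)
      + (partial 1 (partial 3 v) p - Fx p * partial 1 w p / 2) * (y $ 1 * z $ 3 + y $ 3 * z $ 1)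
      + partial 2 (partial 2 v) p * (y $ 2 * z $ 2)
      + (partial 2 (partial 3 v) p - Fx p * partial 1 v p / 2 - Fx p * partial 2 w p / 2)
        * (y $ 2 * z $ 3 + y $ 3 * z $ 2)
      + (partial 3 (partial 3 v) p - (v p * partial 2 Fx p + w p * partial 2 Fy p) / 2
         - Fy p * partial 1 v p / 2 + Fx p * partial 2 v p / 2 - Fx p * partial 3 w p)
        * (y $ 3 * z $ 3)" (is ?thesis2)
    and "lie_connection (levi_civita g) X Y Z p $ 3 =
      partial 1 (partial 1 w) p * (y $ 1 * z $ 1)
      + partial 1 (partial 2 w) p * (y $ 1 * z $ 2 + y $ 2 * z $ 1)
      + partial 1 (partial 3 w) p * (y $ 1 * z $ 3 + y $ 3 * z $ 1)
      + partial 2 (partial 2 w) p * (y $ 2 * z $ 2)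
      + (partial 2 (partial 3 w) p - Fx p * partial 1 w p / 2) * (y $ 2 * z $ 3 + y $ 3 * z $ 2)
      + (partial 3 (partial 3 w) p - Fy p * partial 1 w p / 2 + Fx p * partial 2 w p / 2)
        * (y $ 3 * z $ 3)" (is ?thesis3)
proof -
  have diff: "christoffel g k i j differentiable (at p)" for k i j
    using has_derivative_christoffel[OF p] unfolding differentiable_def by blast
  have dF: "frechet_derivative Fx (at p) (X p) = v p * partial 2 Fx p + w p * partial 2 Fy p"
    "frechet_derivative Fy (at p) (X p) = v p * partial 2 Fy p + w p * partial 3 Fy p"
    using frechet_derivative_partial[OF smooth_on_differentiable[OF smooth_on_partial[OF smooth_F] p]]
      partial_t_partial_F[OF p] partial_commutes[OF smooth_F p] by simp_all
  note unf = lie_connection_eq[OF X Y Z open_M p diff] christoffel_map_walker[OF p]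
    christoffel_deriv_walker[OF p] vector_add_component vector_minus_component vector_3
    second_derivative_component[OF p] frechet_derivative_component[OF smooth_on_differentiable[OF X p]]
    dF y_def z_def
  show ?thesis1 unfolding unf by (simp add: field_simps)
  show ?thesis2 unfolding unf by (simp add: field_simps)
  show ?thesis3 unfolding unf by (simp add: field_simps)
qed

lemma affine_iff: "affine_vf_on M g X \<longleftrightarrow> (\<forall>p\<in>M. affine_eqs p)"
proof
  assume aff: "affine_vf_on M g X"
  show "\<forall>p\<in>M. affine_eqs p"
  proof
    fix p assume p: "p \<in> M"
    have q: "0 = lie_connection (levi_civita g) X (\<lambda>_. axis i 1) (\<lambda>_. axis j 1) p $ k" for i j k
      using aff p unfolding affine_vf_on_def by (simp add: smooth_on_const)
    note q1 = q[of _ _ 1, unfolded lie_connection_quadratic_form[OF smooth_on_const smooth_on_const p]]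
    note q2 = q[of _ _ 2, unfolded lie_connection_quadratic_form[OF smooth_on_const smooth_on_const p]]
    note q3 = q[of _ _ 3, unfolded lie_connection_quadratic_form[OF smooth_on_const smooth_on_const p]]
    show "affine_eqs p"
      unfolding affine_eqs_def
      by (intro conjI)
        (use q1[of 1 1] q1[of 1 2] q1[of 1 3] q1[of 2 2] q1[of 2 3] q1[of 3 3]
          q2[of 1 1] q2[of 1 2] q2[of 1 3] q2[of 2 2] q2[of 2 3] q2[of 3 3]
          q3[of 1 1] q3[of 1 2] q3[of 1 3] q3[of 2 2] q3[of 2 3] q3[of 3 3]
          in \<open>simp_all add: axis_def\<close>)
  qed
next
  assume eqs: "\<forall>p\<in>M. affine_eqs p"
  show "affine_vf_on M g X"
    unfolding affine_vf_on_def
  proof (intro allI impI ballI)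
    fix Y Z :: "real^3 \<Rightarrow> real^3" and p assume YZ: "smooth_on M Y" "smooth_on M Z" and p: "p \<in> M"
    from eqs p have "affine_eqs p" by blast
    then show "lie_connection (levi_civita g) X Y Z p = 0"
      unfolding vec_eq_iff forall_3 lie_connection_quadratic_form[OF YZ p] affine_eqs_def
      by (elim conjE) (simp only: mult_zero_left add_0 zero_index simp_thms)
  qed
qed

end

section \<open>Constancy, coordinate slices and functions of y alone\<close>

context walker_box
begin

lemma partial_eq_zeroI:
  assumes "smooth_on M h" "p \<in> M" "\<And>q. q \<in> M \<Longrightarrow> h q = 0"
  shows "partial i h p = 0"
  using partial_eq[OF assms(3,1,2), of i] by simp

lemma const_on_M:
  assumes "smooth_on M h" "\<And>q. q \<in> M \<Longrightarrow> partial 1 h q = 0" "\<And>q. q \<in> M \<Longrightarrow> partial 2 h q = 0"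
    "\<And>q. q \<in> M \<Longrightarrow> partial 3 h q = 0"
  obtains c where "\<And>p. p \<in> M \<Longrightarrow> h p = c"
proof -
  have "partial i h q = 0" if "q \<in> M" for i q
    using exhaust_3[of i] assms(2-4)[OF that] by auto
  then have "h p = h q" if "p \<in> M" "q \<in> M" for p q
    using partial_zero_imp_eq[OF assms(1) convex_M that] by blast
  then show thesis using that[of "h (SOME p. p \<in> M)"] by (metis someI)
qed

lemma has_real_derivative_slice:
  assumes h: "smooth_on M h" and p: "c + s *\<^sub>R axis i 1 \<in> M"
  shows "((\<lambda>s. h (c + s *\<^sub>R axis i 1)) has_real_derivative partial i h (c + s *\<^sub>R axis i 1)) (at s)"
proof -
  have "((\<lambda>s. c + s *\<^sub>R axis i 1) has_derivative (\<lambda>r. r *\<^sub>R axis i 1)) (at s)"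
    by (rule derivative_eq_intros refl | simp)+
  note has_derivative_compose[OF this smooth_on_has_derivative[OF h p]]
  moreover have "r * partial i h (c + s *\<^sub>R axis i 1)
      = frechet_derivative h (at (c + s *\<^sub>R axis i 1)) (r *\<^sub>R axis i 1)" for r
    unfolding partial_def linear_scale[OF has_derivative_linear[OF smooth_on_has_derivative[OF h p]]]
    by simp
  ultimately show ?thesis by (rule has_derivative_imp_has_field_derivative)
qed

lemma vector_in_M: "vector [t, x, y] \<in> M \<longleftrightarrow> t \<in> T \<and> x \<in> I \<and> y \<in> J"
  by (simp add: coord_box_def)

text \<open>The base points have a coordinate 0 and may lie outside \<open>M\<close>;
  \<open>has_real_derivative_slice\<close> asks only that the point reached on the line belong to
  \<open>M\<close>.\<close>

lemma vector_slice:
  "vector [t, x, y] = vector [t, 0, y] + x *\<^sub>R (axis 2 1 :: real^3)"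
  "vector [t, x, y] = vector [t, x, 0] + y *\<^sub>R (axis 3 1 :: real^3)"
  by (simp_all add: vec_eq_iff forall_3 axis_def)

lemma smooth_slice:
  assumes h: "smooth_on M h" and tx: "t \<in> T" "x \<in> I"
  shows "smooth_on J (\<lambda>y. h (vector [t, x, y]))"
    and "y \<in> J \<Longrightarrow> deriv (\<lambda>y. h (vector [t, x, y])) y = partial 3 h (vector [t, x, y])"
proof -
  have J: "open J" using J by (simp add: open_interval_def)
  have eq: "(\<lambda>y. h (vector [t, x, y])) = (\<lambda>y. h (vector [t, x, 0] + y *\<^sub>R axis 3 1))"
    by (rule ext) (rule arg_cong[OF vector_slice(2)])
  show "smooth_on J (\<lambda>y. h (vector [t, x, y]))"
    unfolding eq
    by (rule smooth_on_affine_compose[OF J _ _ h])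
      (use tx in \<open>auto simp: vector_slice(2)[symmetric] vector_in_M bounded_linear_scaleR_left\<close>)
  show "deriv (\<lambda>y. h (vector [t, x, y])) y = partial 3 h (vector [t, x, y])" if "y \<in> J"
    unfolding eq
    using DERIV_imp_deriv[OF has_real_derivative_slice[OF h, of "vector [t, x, 0]" y 3]] tx that
    by (simp add: vector_slice(2)[symmetric] vector_in_M)
qed

lemma dx_eq: "t \<in> T \<Longrightarrow> x \<in> I \<Longrightarrow> y \<in> J \<Longrightarrow> dx f x y = Fx (vector [t, x, y])"
  using DERIV_imp_deriv[OF has_real_derivative_slice[OF smooth_F, of "vector [t, 0, y]" x 2]]
  by (simp add: vector_slice(1)[symmetric] vector_in_M dx_def F_def)

lemma dy_eq: "t \<in> T \<Longrightarrow> x \<in> I \<Longrightarrow> y \<in> J \<Longrightarrow> dy f x y = Fy (vector [t, x, y])"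
  using DERIV_imp_deriv[OF has_real_derivative_slice[OF smooth_F, of "vector [t, x, 0]" y 3]]
  by (simp add: vector_slice(2)[symmetric] vector_in_M dy_def F_def)

lemma dx_dx_eq:
  assumes "t \<in> T" "x \<in> I" "y \<in> J"
  shows "dx (dx f) x y = partial 2 Fx (vector [t, x, y])"
proof -
  have "open I" using I by (simp add: open_interval_def)
  \<comment> \<open>\<open>dx f\<close> is identified with \<open>Fx\<close> only over
    \<open>I\<close>; agreement near \<open>x\<close> is enough to differentiate again.\<close>
  from eventually_nhds_in_open[OF this assms(2)]
  have "\<forall>\<^sub>F s in nhds x. dx f s y = Fx (vector [t, s, y])"
    by (rule eventually_mono) (rule dx_eq[OF assms(1) _ assms(3)])
  then have "dx (dx f) x y = deriv (\<lambda>s. Fx (vector [t, s, y])) x"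
    unfolding dx_def[of "dx f"] by (intro deriv_cong_ev) auto
  then show ?thesis
    using DERIV_imp_deriv[OF has_real_derivative_slice[OF smooth_on_partial[OF smooth_F, of 2], of "vector [t, 0, y]" x 2]] assms
    by (simp add: vector_slice(1)[symmetric] vector_in_M)
qed

lemma smooth_lift:
  assumes h: "smooth_on J h"
  shows "smooth_on M (\<lambda>p. h (p $ 3))"
    and "p \<in> M \<Longrightarrow> partial i (\<lambda>p. h (p $ 3)) p = (if i = 3 then deriv h (p $ 3) else 0)"
proof -
  have "smooth_on M (\<lambda>p::real^3. h (0 + p $ 3))"
    by (rule smooth_on_affine_compose[OF open_M bounded_linear_vec_nth _ h]) (simp add: coord_box_def)
  then show "smooth_on M (\<lambda>p. h (p $ 3))" by simp
  assume "p \<in> M"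
  then have "p $ 3 \<in> J" by (simp add: coord_box_def)
  from smooth_on_has_derivative[OF h this]
  have h': "(h has_derivative frechet_derivative h (at (p $ 3))) (at (p $ 3))" .
  have "((\<lambda>p::real^3. h (p $ 3)) has_derivative (\<lambda>v. frechet_derivative h (at (p $ 3)) (v $ 3))) (at p)"
    by (rule has_derivative_compose[OF bounded_linear_imp_has_derivative[OF bounded_linear_vec_nth] h'])
  then have "partial i (\<lambda>p. h (p $ 3)) p = frechet_derivative h (at (p $ 3)) (axis i 1 $ 3)"
    unfolding partial_def by (rule frechet_derivative_eqI)
  moreover have "frechet_derivative h (at (p $ 3)) 1 = deriv h (p $ 3)"
  proof (rule DERIV_imp_deriv[OF has_derivative_imp_has_field_derivative[OF h'], symmetric])
    show "r * frechet_derivative h (at (p $ 3)) 1 = frechet_derivative h (at (p $ 3)) r" for r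
      using linear_scale[OF has_derivative_linear[OF h'], of r 1] by simp
  qed
  ultimately show "partial i (\<lambda>p. h (p $ 3)) p = (if i = 3 then deriv h (p $ 3) else 0)"
    using linear_0[OF has_derivative_linear[OF h']] by (simp add: axis_def)
qed

text \<open>Smoothness is phrased with \<open>frechet_derivative\<close>, not \<open>deriv\<close>.
  Lifting \<open>h\<close> to the box turns \<open>deriv h\<close> into a y-partial, which is
  smooth, and restriction to a y-line brings it back.\<close>

lemma smooth_deriv:
  assumes h: "smooth_on J h"
  shows "smooth_on J (deriv h)"
proof -
  have J: "open J" using J by (simp add: open_interval_def)
  obtain t x where tx: "t \<in> T" "x \<in> I" using T I by (auto simp: open_interval_def)
  show ?thesis
    by (rule smooth_on_cong[OF J _ smooth_slice(1)[OF smooth_on_partial[OF smooth_lift(1)[OF h], of 3] tx]])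
      (use tx in \<open>simp add: smooth_lift(2)[OF h] vector_in_M\<close>)
qed

end

section \<open>The normal form of the field and the remaining equation\<close>

context walker_field
begin

lemmas smooth_simps = smooth_intros X smooth_uvw

text \<open>The common target of both analyses. The homothetic case has c3 = eta - c1 and d = eta/2,
  the affine case d = (c1 + c3)/2. The y-derivatives of \<open>u\<close> and \<open>v\<close> stay
  free up to the last relation, and this freedom becomes \<open>f1\<close> and
  \<open>f2\<close>.\<close>

definition normal_eqs :: "real \<Rightarrow> real \<Rightarrow> real \<Rightarrow> real^3 \<Rightarrow> bool" where
  "normal_eqs c1 c3 d p \<longleftrightarrow> partial 1 w p = 0 \<and> partial 2 w p = 0 \<and> partial 3 w p = c1
     \<and> partial 1 v p = 0 \<and> partial 2 v p = d \<and> partial 1 u p = c3 \<and> partial 2 u p = - partial 3 v p"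

definition normal_form :: "real \<Rightarrow> real \<Rightarrow> real \<Rightarrow> real \<Rightarrow> (real \<Rightarrow> real) \<Rightarrow> (real \<Rightarrow> real) \<Rightarrow> bool" where
  "normal_form c1 c2 c3 d f1 f2 \<longleftrightarrow> smooth_on J f1 \<and> smooth_on J f2 \<and>
     (\<forall>t\<in>T. \<forall>x\<in>I. \<forall>y\<in>J. X (vector [t, x, y]) =
          vector [c3 * t - x * deriv f1 y + f2 y, d * x + f1 y, c1 * y + c2])"

lemma normal_formD:
  assumes nf: "normal_form c1 c2 c3 d f1 f2" and p: "p \<in> M"
  shows "normal_eqs c1 c3 d p"
    and "partial 3 u p = - p $ 2 * deriv (deriv f1) (p $ 3) + deriv f2 (p $ 3)"
    and "v p = d * p $ 2 + f1 (p $ 3)" and "w p = c1 * p $ 3 + c2"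
proof -
  have f12: "smooth_on J f1" "smooth_on J f2" using nf by (auto simp: normal_form_def)
  have Xq: "X q = vector [c3 * q $ 1 - q $ 2 * deriv f1 (q $ 3) + f2 (q $ 3), d * q $ 2 + f1 (q $ 3), c1 * q $ 3 + c2]"
    if "q \<in> M" for q
  proof -
    have "q $ 1 \<in> T" "q $ 2 \<in> I" "q $ 3 \<in> J" using that by (simp_all add: coord_box_def)
    then have "X (vector [q $ 1, q $ 2, q $ 3]) = vector [c3 * q $ 1 - q $ 2 * deriv f1 (q $ 3) + f2 (q $ 3),
      d * q $ 2 + f1 (q $ 3), c1 * q $ 3 + c2]"
      using nf unfolding normal_form_def by blast
    then show ?thesis by (simp add: vector_collapse3)
  qed
  have u: "partial i u p = partial i (\<lambda>q. c3 * q $ 1 - q $ 2 * deriv f1 (q $ 3) + f2 (q $ 3)) p"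
    and v: "partial i v p = partial i (\<lambda>q. d * q $ 2 + f1 (q $ 3)) p"
    and w: "partial i w p = partial i (\<lambda>q. c1 * q $ 3 + c2) p" for i
    by (rule partial_eq[OF _ _ p]; simp add: Xq smooth_uvw)+
  note sm = smooth_simps smooth_lift[OF f12(1)] smooth_lift[OF f12(2)] smooth_lift[OF smooth_deriv[OF f12(1)]] p
  show "normal_eqs c1 c3 d p" unfolding normal_eqs_def u v w
    by (simp add: partial_simps sm)
  show "partial 3 u p = - p $ 2 * deriv (deriv f1) (p $ 3) + deriv f2 (p $ 3)" unfolding u
    by (simp add: partial_simps sm)
  show "v p = d * p $ 2 + f1 (p $ 3)" "w p = c1 * p $ 3 + c2" using Xq[OF p] by simp_all
qed

text \<open>Here w - c1 y is constant, and v - d x and v_y depend on y alone. Because u_x = - v_y,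
  the same is true of u - c3 t + x v_y, which explains the term with \<open>deriv f1\<close> in the
  normal form.\<close>

lemma normal_form_exists:
  assumes eqs: "\<And>p. p \<in> M \<Longrightarrow> normal_eqs c1 c3 d p"
  obtains c2 f1 f2 where "normal_form c1 c2 c3 d f1 f2"
proof -
  obtain t0 x0 where tx: "t0 \<in> T" "x0 \<in> I" using T I by (auto simp: open_interval_def)
  note e = eqs[unfolded normal_eqs_def]
  have p13v: "partial 1 (partial 3 v) p = 0" and p23v: "partial 2 (partial 3 v) p = 0" if p: "p \<in> M" for p
  proof -
    have "partial 3 (partial 1 v) p = 0" by (rule partial_eq_zeroI) (simp_all add: smooth_simps p e)
    moreover have "partial 3 (\<lambda>q. partial 2 v q - d) p = 0"
      by (rule partial_eq_zeroI) (simp_all add: smooth_simps p e)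
    ultimately show "partial 1 (partial 3 v) p = 0" "partial 2 (partial 3 v) p = 0"
      using partial_commutes[OF smooth_uvw(2) p] by (simp_all add: partial_simps smooth_simps p)
  qed
  \<comment> \<open>\<open>f1\<close> and \<open>f2\<close> are the y-only functions v - d x and u -
    c3 t + x v_y, read off along the line through (t0, x0).\<close>
  define f1 where "f1 = (\<lambda>y. v (vector [t0, x0, y]) - d * x0)"
  define f2 where "f2 = (\<lambda>y. u (vector [t0, x0, y]) - c3 * t0 + x0 * partial 3 v (vector [t0, x0, y]))"
  have J: "open J" using J by (simp add: open_interval_def)
  have "smooth_on J f1" "smooth_on J f2" unfolding f1_def f2_def
    by (intro smooth_on_add[OF J] smooth_on_diff[OF J] smooth_on_mult[OF J] smooth_on_const
        smooth_slice(1)[OF _ tx] smooth_on_partial smooth_uvw)+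
  moreover obtain c2 where c2: "\<And>p. p \<in> M \<Longrightarrow> w p - c1 * p $ 3 = c2"
    by (rule const_on_M[of "\<lambda>p. w p - c1 * p $ 3"]) (simp_all add: smooth_simps partial_simps e)
  moreover have "X (vector [t, x, y]) = vector [c3 * t - x * deriv f1 y + f2 y, d * x + f1 y, c1 * y + c2]"
    if "t \<in> T" "x \<in> I" "y \<in> J" for t x y
  proof -
    let ?p = "vector [t, x, y] :: real^3" and ?q = "vector [t0, x0, y] :: real^3"
    have pq: "?p \<in> M" "?q \<in> M" using that tx by (simp_all add: vector_in_M)
    \<comment> \<open>\<open>?p\<close> and \<open>?q\<close> have the same y-coordinate, so
      vanishing t- and x-partials are enough.\<close>
    have move: "h ?p = h ?q" if "smooth_on M h" "\<And>r. r \<in> M \<Longrightarrow> partial 1 h r = 0" "\<And>r. r \<in> M \<Longrightarrow> partial 2 h r = 0"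
      for h
    proof (rule partial_zero_imp_eq[OF that(1) convex_M pq])
      show "partial i h r = 0" if "r \<in> M" "?p $ i \<noteq> ?q $ i" for i r
        using that \<open>\<And>r. r \<in> M \<Longrightarrow> partial 1 h r = 0\<close> \<open>\<And>r. r \<in> M \<Longrightarrow> partial 2 h r = 0\<close> exhaust_3[of i] by auto
    qed
    have v: "v ?p - d * ?p $ 2 = v ?q - d * ?q $ 2"
      by (rule move) (simp_all add: smooth_simps partial_simps e)
    have v3: "partial 3 v ?p = partial 3 v ?q"
      by (rule move) (simp_all add: smooth_simps p13v p23v)
    have "deriv f1 y = deriv (\<lambda>y. (\<lambda>q. v q - d * x0) (vector [t0, x0, y])) y"
      by (simp add: f1_def)
    also have "\<dots> = partial 3 v ?q"
      by (subst smooth_slice(2)[OF _ tx that(3)]) (simp_all add: smooth_simps partial_simps pq)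
    finally have df1: "deriv f1 y = partial 3 v ?p" using v3 by simp
    have u: "u ?p - c3 * ?p $ 1 + ?p $ 2 * partial 3 v ?p = u ?q - c3 * ?q $ 1 + ?q $ 2 * partial 3 v ?q"
      by (rule move) (simp_all add: smooth_simps partial_simps e p13v p23v)
    show ?thesis
      using u v c2[OF pq(1)] unfolding df1 by (simp add: vec_eq_iff forall_3 f1_def f2_def algebra_simps)
  qed
  ultimately show thesis using that[of c2 f1 f2] unfolding normal_form_def by blast
qed

text \<open>In normal form, u_y, v and w are explicit, and substituting them turns one equation into
  the other. As the explicit equation does not contain t, any point of \<open>T\<close> lifts (x, y)
  into the box. The parameters \<open>a\<close> and \<open>c4\<close> let one lemma serve all
  cases.\<close>

lemma structure_equation_iff:
  assumes nf: "normal_form c1 c2 c3 d f1 f2"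
  shows "(\<forall>x\<in>I. \<forall>y\<in>J. a * f x y - 2 * deriv (deriv f1) y * x + 2 * deriv f2 y
          + (d * x + f1 y) * dx f x y + (c1 * y + c2) * dy f x y + c4 = 0)
    \<longleftrightarrow> (\<forall>p\<in>M. a * F p + 2 * partial 3 u p + v p * Fx p + w p * Fy p + c4 = 0)"
proof -
  obtain t0 where t0: "t0 \<in> T" using T by (auto simp: open_interval_def)
  have eq: "a * F p + 2 * partial 3 u p + v p * Fx p + w p * Fy p + c4 =
    a * f (p $ 2) (p $ 3) - 2 * deriv (deriv f1) (p $ 3) * p $ 2 + 2 * deriv f2 (p $ 3)
          + (d * p $ 2 + f1 (p $ 3)) * dx f (p $ 2) (p $ 3) + (c1 * p $ 3 + c2) * dy f (p $ 2) (p $ 3) + c4"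
    if p: "p \<in> M" for p
  proof -
    have "p $ 1 \<in> T" "p $ 2 \<in> I" "p $ 3 \<in> J" using that by (simp_all add: coord_box_def)
    from dx_eq[OF this] dy_eq[OF this] show ?thesis
      unfolding vector_collapse3 normal_formD(2,3,4)[OF nf p] by (simp add: F_def)
  qed
  show ?thesis (is "?L \<longleftrightarrow> ?R")
  proof
    assume ?L
    show ?R
    proof
      fix p assume p: "p \<in> M"
      then have "p $ 2 \<in> I" "p $ 3 \<in> J" by (simp_all add: coord_box_def)
      with \<open>?L\<close> show "a * F p + 2 * partial 3 u p + v p * Fx p + w p * Fy p + c4 = 0"
        unfolding eq[OF p] by blast
    qed
  next
    assume ?R
    show ?L
    proof (intro ballI)
      fix x y assume "x \<in> I" "y \<in> J"
      then have p: "vector [t0, x, y] \<in> M" using t0 by (simp add: vector_in_M)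
      with \<open>?R\<close> eq[OF p] show "a * f x y - 2 * deriv (deriv f1) y * x + 2 * deriv f2 y
          + (d * x + f1 y) * dx f x y + (c1 * y + c2) * dy f x y + c4 = 0"
        by simp
    qed
  qed
qed

end

section \<open>Solving the equations\<close>

context walker_field
begin

text \<open>The equations are of first order, so the second-order relations must first be produced
  by cross differentiation. The tx equation ties v_t to - w_x, and w_x is the one unknown removed by
  means of f_xx.\<close>

lemma homothetic_imp_normal_eqs:
  assumes Fxx: "\<And>p. p \<in> M \<Longrightarrow> partial 2 Fx p \<noteq> 0"
    and hom: "\<And>p. p \<in> M \<Longrightarrow> homothetic_eqs \<eta> p"
  obtains c1 where "\<And>p. p \<in> M \<Longrightarrow> normal_eqs c1 (\<eta> - c1) (\<eta> / 2) p"
proof -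
  note e = hom[unfolded homothetic_eqs_def]
  have e1: "partial 1 w p = 0" and e2: "partial 2 w p + partial 1 v p = 0"
    and e3: "partial 3 w p + partial 1 u p - \<eta> = 0" and e4: "partial 2 v p - \<eta> / 2 = 0"
    and e5: "partial 3 v p + partial 2 u p + F p * partial 2 w p = 0"
    and e6: "v p * Fx p + w p * Fy p + 2 * (partial 3 u p + F p * partial 3 w p) - \<eta> * F p = 0"
    if "p \<in> M" for p
    using e[OF that] by auto
  note comm = smooth_uvw[THEN partial_commutes(1)] smooth_uvw[THEN partial_commutes(2)] smooth_uvw[THEN partial_commutes(3)]
  note sm = smooth_simps partial_simps comm partial_F_t partial_t_partial_F
  \<comment> \<open>Each \<open>partial_eq_zeroI\<close> differentiates one equation in the
    direction given by the final number; the identity function says that the equation is taken at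
    the point of differentiation.\<close>
  have w12: "partial 1 (partial 2 w) p = 0" and w13: "partial 1 (partial 3 w) p = 0" if p: "p \<in> M" for p
    using partial_eq_zeroI[OF _ p e1, of "\<lambda>q. q" 2] partial_eq_zeroI[OF _ p e1, of "\<lambda>q. q" 3] by (simp_all add: sm p)
  have v12: "partial 1 (partial 2 v) p = 0" if p: "p \<in> M" for p
    using partial_eq_zeroI[OF _ p e4, of "\<lambda>q. q" 1] by (simp add: sm p)
  have w22: "partial 2 (partial 2 w) p = 0" if p: "p \<in> M" for p
    using partial_eq_zeroI[OF _ p e2, of "\<lambda>q. q" 2] by (simp add: sm p v12)
  \<comment> \<open>Differentiating xy in t, tx in y and ty in x shows that any two of v_ty, u_tx
    and w_xy add up to zero, so all three vanish.\<close>
  have w23: "partial 2 (partial 3 w) p = 0" if p: "p \<in> M" for p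
    using partial_eq_zeroI[OF _ p e5, of "\<lambda>q. q" 1] partial_eq_zeroI[OF _ p e2, of "\<lambda>q. q" 3] partial_eq_zeroI[OF _ p e3, of "\<lambda>q. q" 2]
    by (simp add: sm p w12)
  \<comment> \<open>The t-derivative of the yy equation brings in f_x; the y-derivative of the ty
    equation then trades u_ty for - w_yy.\<close>
  have w33: "partial 2 w p * Fx p + 2 * partial 3 (partial 3 w) p = 0" if p: "p \<in> M" for p
  proof -
    have "partial 1 v p * Fx p + 2 * partial 1 (partial 3 u) p = 0"
      using partial_eq_zeroI[OF _ p e6, of "\<lambda>q. q" 1] by (simp add: sm p e1 w13)
    moreover have "partial 3 (partial 3 w) p + partial 1 (partial 3 u) p = 0"
      using partial_eq_zeroI[OF _ p e3, of "\<lambda>q. q" 3] by (simp add: sm p)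
    moreover have "partial 1 v p = - partial 2 w p" using e2[OF p] by simp
    ultimately show ?thesis by simp
  qed
  \<comment> \<open>In the x-derivative of \<open>w33\<close> the terms with w_xx and w_xyy vanish,
    leaving w_x f_xx = 0.\<close>
  have w2: "partial 2 w p = 0" if p: "p \<in> M" for p
  proof -
    have "partial 3 (partial 2 (partial 3 w)) p = 0"
      by (rule partial_eq_zeroI[OF _ p w23]) (simp_all add: sm)
    then have "partial 2 (partial 3 (partial 3 w)) p = 0"
      using partial_commutes(3)[OF smooth_on_partial[OF smooth_uvw(3)] p] by simp
    then have "partial 2 w p * partial 2 Fx p = 0"
      using partial_eq_zeroI[OF _ p w33, of "\<lambda>q. q" 2] by (simp add: sm p w22)
    then show ?thesis using Fxx[OF p] by simp
  qed
  have w33': "partial 3 (partial 3 w) p = 0" if p: "p \<in> M" for p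
    using w33[OF p] w2[OF p] by simp
  obtain c1 where c1: "\<And>p. p \<in> M \<Longrightarrow> partial 3 w p = c1"
    by (rule const_on_M[OF smooth_on_partial[OF smooth_uvw(3)] w13 w23 w33']) (assumption | rule that)+
  have "normal_eqs c1 (\<eta> - c1) (\<eta> / 2) p" if p: "p \<in> M" for p
    using e1[OF p] w2[OF p] c1[OF p] e2[OF p] e3[OF p] e4[OF p] e5[OF p] unfolding normal_eqs_def by simp
  then show thesis by (rule that)
qed

text \<open>Under \<open>normal_eqs\<close> five of the six equations hold identically and the yy
  equation is the structure equation. The trailing 0 is the value of \<open>c4\<close> in
  \<open>structure_equation_iff\<close>.\<close>

lemma homothetic_const_characterization:
  assumes Fxx: "\<And>p. p \<in> M \<Longrightarrow> partial 2 Fx p \<noteq> 0"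
  shows "homothetic_const_on M g \<eta> X \<longleftrightarrow>
    (\<exists>c1 c2 f1 f2. normal_form c1 c2 (\<eta> - c1) (\<eta> / 2) f1 f2 \<and>
      (\<forall>x\<in>I. \<forall>y\<in>J. (2 * c1 - \<eta>) * f x y - 2 * deriv (deriv f1) y * x + 2 * deriv f2 y
          + (\<eta> / 2 * x + f1 y) * dx f x y + (c1 * y + c2) * dy f x y + 0 = 0))"
proof -
  have equiv: "homothetic_eqs \<eta> p \<longleftrightarrow>
      (2 * c1 - \<eta>) * F p + 2 * partial 3 u p + v p * Fx p + w p * Fy p + 0 = 0"
    if "normal_eqs c1 (\<eta> - c1) (\<eta> / 2) p" for c1 p
    using that unfolding homothetic_eqs_def normal_eqs_def by (auto simp: algebra_simps)
  show ?thesis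
  proof
    assume "homothetic_const_on M g \<eta> X"
    then have hom: "\<And>p. p \<in> M \<Longrightarrow> homothetic_eqs \<eta> p" by (simp add: homothetic_const_iff)
    obtain c1 where ne: "\<And>p. p \<in> M \<Longrightarrow> normal_eqs c1 (\<eta> - c1) (\<eta> / 2) p"
      by (rule homothetic_imp_normal_eqs[OF Fxx hom]) (assumption | rule that)+
    obtain c2 f1 f2 where nf: "normal_form c1 c2 (\<eta> - c1) (\<eta> / 2) f1 f2"
      by (rule normal_form_exists[OF ne])
    have "\<forall>p\<in>M. (2 * c1 - \<eta>) * F p + 2 * partial 3 u p + v p * Fx p + w p * Fy p + 0 = 0"
      using hom equiv[OF ne] by blast
    with nf show "\<exists>c1 c2 f1 f2. normal_form c1 c2 (\<eta> - c1) (\<eta> / 2) f1 f2 \<and>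
      (\<forall>x\<in>I. \<forall>y\<in>J. (2 * c1 - \<eta>) * f x y - 2 * deriv (deriv f1) y * x + 2 * deriv f2 y
          + (\<eta> / 2 * x + f1 y) * dx f x y + (c1 * y + c2) * dy f x y + 0 = 0)"
      unfolding structure_equation_iff[OF nf, symmetric] by blast
  next
    assume "\<exists>c1 c2 f1 f2. normal_form c1 c2 (\<eta> - c1) (\<eta> / 2) f1 f2 \<and>
      (\<forall>x\<in>I. \<forall>y\<in>J. (2 * c1 - \<eta>) * f x y - 2 * deriv (deriv f1) y * x + 2 * deriv f2 y
          + (\<eta> / 2 * x + f1 y) * dx f x y + (c1 * y + c2) * dy f x y + 0 = 0)"
    then obtain c1 c2 f1 f2 where nf: "normal_form c1 c2 (\<eta> - c1) (\<eta> / 2) f1 f2"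
      and "\<forall>x\<in>I. \<forall>y\<in>J. (2 * c1 - \<eta>) * f x y - 2 * deriv (deriv f1) y * x + 2 * deriv f2 y
          + (\<eta> / 2 * x + f1 y) * dx f x y + (c1 * y + c2) * dy f x y + 0 = 0"
      by blast
    then have "\<forall>p\<in>M. (2 * c1 - \<eta>) * F p + 2 * partial 3 u p + v p * Fx p + w p * Fy p + 0 = 0"
      unfolding structure_equation_iff[OF nf] by blast
    then show "homothetic_const_on M g \<eta> X"
      unfolding homothetic_const_iff using equiv[OF normal_formD(1)[OF nf]] by blast
  qed
qed

section \<open>Affine fields\<close>

definition structure_fun :: "real \<Rightarrow> real^3 \<Rightarrow> real" where
  "structure_fun a p = a * F p + 2 * partial 3 u p + v p * Fx p + w p * Fy p"

lemma smooth_structure_fun: "smooth_on M (structure_fun a)"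
  unfolding structure_fun_def[abs_def] by (intro smooth_simps)

lemma partial_structure_fun:
  assumes p: "p \<in> M"
  shows "partial 1 (structure_fun a) p = 2 * partial 1 (partial 3 u) p + partial 1 v p * Fx p + partial 1 w p * Fy p"
    and "partial 2 (structure_fun a) p = a * Fx p + 2 * partial 2 (partial 3 u) p
      + partial 2 v p * Fx p + v p * partial 2 Fx p + partial 2 w p * Fy p + w p * partial 2 Fy p"
    and "partial 3 (structure_fun a) p = a * Fy p + 2 * partial 3 (partial 3 u) p
      + partial 3 v p * Fx p + v p * partial 2 Fy p + partial 3 w p * Fy p + w p * partial 3 Fy p"
  unfolding structure_fun_def[abs_def]
  by (simp_all add: smooth_simps partial_simps p partial_F_t partial_t_partial_F partial_commutes[OF smooth_F])

text \<open>In the \<open>w\<close> block the xy and yy equations carry f_x w_t and f_x w_x, and in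
  the \<open>v\<close> block the xy equation carries f_x v_t. Once f_xx has removed these unknowns,
  the second-order equations say that w_y, v_x and u_t have zero gradient.\<close>

lemma affine_imp_normal_eqs:
  assumes Fxx: "\<And>p. p \<in> M \<Longrightarrow> partial 2 Fx p \<noteq> 0"
    and aff: "\<And>p. p \<in> M \<Longrightarrow> affine_eqs p"
  obtains c1 c3 where "\<And>p. p \<in> M \<Longrightarrow> normal_eqs c1 c3 ((c1 + c3) / 2) p"
proof -
  note e = aff[unfolded affine_eqs_def]
  have w11: "partial 1 (partial 1 w) p = 0" and w12: "partial 1 (partial 2 w) p = 0"
    and w13: "partial 1 (partial 3 w) p = 0" and w22: "partial 2 (partial 2 w) p = 0"
    and w23: "2 * partial 2 (partial 3 w) p - Fx p * partial 1 w p = 0"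
    and w33: "2 * partial 3 (partial 3 w) p - Fy p * partial 1 w p + Fx p * partial 2 w p = 0"
    if "p \<in> M" for p
    using e[OF that] by (elim conjE; simp add: field_simps)+
  have v11: "partial 1 (partial 1 v) p = 0" and v12: "partial 1 (partial 2 v) p = 0"
    and v13: "2 * partial 1 (partial 3 v) p - Fx p * partial 1 w p = 0" and v22: "partial 2 (partial 2 v) p = 0"
    and v23: "2 * partial 2 (partial 3 v) p - Fx p * partial 1 v p - Fx p * partial 2 w p = 0"
    and v33: "2 * partial 3 (partial 3 v) p - (v p * partial 2 Fx p + w p * partial 2 Fy p)
         - Fy p * partial 1 v p + Fx p * partial 2 v p - 2 * Fx p * partial 3 w p = 0"
    if "p \<in> M" for p
    using e[OF that] by (elim conjE; simp add: field_simps)+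
  have u11: "partial 1 (partial 1 u) p = 0" and u12: "2 * partial 1 (partial 2 u) p + Fx p * partial 1 w p = 0"
    and u13: "2 * partial 1 (partial 3 u) p + Fx p * partial 1 v p + Fy p * partial 1 w p = 0"
    and u22: "partial 2 (partial 2 u) p + Fx p * partial 2 w p = 0"
    and u23: "2 * partial 2 (partial 3 u) p + (v p * partial 2 Fx p + w p * partial 2 Fy p)
         - Fx p * partial 1 u p + Fx p * partial 2 v p + Fy p * partial 2 w p + Fx p * partial 3 w p = 0"
    and u33: "2 * partial 3 (partial 3 u) p + (v p * partial 2 Fy p + w p * partial 3 Fy p)
         - Fy p * partial 1 u p + Fx p * partial 2 u p + 2 * Fx p * partial 3 v p + 2 * Fy p * partial 3 w p = 0"
    if "p \<in> M" for p
    using e[OF that] by (elim conjE; simp add: field_simps)+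
  note comm = smooth_uvw[THEN partial_commutes(1)] smooth_uvw[THEN partial_commutes(2)] smooth_uvw[THEN partial_commutes(3)]
  note sm = smooth_simps partial_simps comm partial_F_t partial_t_partial_F
  \<comment> \<open>This fact and \<open>d233\<close> kill the second-order term that remains when
    an xy or yy equation is differentiated in x.\<close>
  have d232: "partial 2 (partial 2 (partial 3 h)) p = 0"
    if h: "smooth_on M h" and z: "\<And>p. p \<in> M \<Longrightarrow> partial 2 (partial 2 h) p = 0" and p: "p \<in> M" for h p
  proof -
    have "partial 2 (partial 3 (partial 2 h)) p = 0"
      using partial_eq_zeroI[OF _ p z, of "\<lambda>q. q" 3] partial_commutes(3)[OF smooth_on_partial[OF h] p]
      by (simp add: smooth_on_partial h)
    moreover have "partial 2 (partial 2 (partial 3 h)) p = partial 2 (partial 3 (partial 2 h)) p"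
      by (rule partial_eq[OF _ _ p]) (simp_all add: smooth_on_partial h partial_commutes(3)[OF h])
    ultimately show ?thesis by simp
  qed
  have d233: "partial 2 (partial 3 (partial 3 h)) p = 0"
    if h: "smooth_on M h" and z: "\<And>p. p \<in> M \<Longrightarrow> partial 2 (partial 3 h) p = 0" and p: "p \<in> M" for h p
    using partial_eq_zeroI[OF _ p z, of "\<lambda>q. q" 3] partial_commutes(3)[OF smooth_on_partial[OF h] p]
    by (simp add: smooth_on_partial h)
  \<comment> \<open>The x-derivative of 2 w_xy = f_x w_t, where w_xxy and w_tx vanish. The same
    argument gives w_x = 0 from the yy equation and v_t = 0 in the next block.\<close>
  have w1: "partial 1 w p = 0" if p: "p \<in> M" for p
    using partial_eq_zeroI[OF _ p w23, of "\<lambda>q. q" 2] d232[OF smooth_uvw(3) w22 p] Fxx[OF p] by (simp add: sm p w12)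
  have w23': "partial 2 (partial 3 w) p = 0" if p: "p \<in> M" for p
    using w23[OF p] w1[OF p] by simp
  have w33': "2 * partial 3 (partial 3 w) p + Fx p * partial 2 w p = 0" if p: "p \<in> M" for p
    using w33[OF p] w1[OF p] by simp
  have w2: "partial 2 w p = 0" if p: "p \<in> M" for p
    using partial_eq_zeroI[OF _ p w33', of "\<lambda>q. q" 2] d233[OF smooth_uvw(3) w23' p] Fxx[OF p] by (simp add: sm p w22)
  have w33'': "partial 3 (partial 3 w) p = 0" if p: "p \<in> M" for p
    using w33'[OF p] w2[OF p] by simp
  obtain c1 where c1: "\<And>p. p \<in> M \<Longrightarrow> partial 3 w p = c1"
    by (rule const_on_M[OF smooth_on_partial[OF smooth_uvw(3)] w13 w23' w33'']) (assumption | rule that)+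
  have v23': "2 * partial 2 (partial 3 v) p - Fx p * partial 1 v p = 0" if p: "p \<in> M" for p
    using v23[OF p] w2[OF p] by simp
  have v1: "partial 1 v p = 0" if p: "p \<in> M" for p
    using partial_eq_zeroI[OF _ p v23', of "\<lambda>q. q" 2] d232[OF smooth_uvw(2) v22 p] Fxx[OF p] by (simp add: sm p v12)
  have v23'': "partial 2 (partial 3 v) p = 0" if p: "p \<in> M" for p
    using v23'[OF p] v1[OF p] by simp
  have v32: "partial 3 (partial 2 v) p = 0" if p: "p \<in> M" for p
    using v23''[OF p] by (simp add: comm p)
  obtain d where d: "\<And>p. p \<in> M \<Longrightarrow> partial 2 v p = d"
    by (rule const_on_M[OF smooth_on_partial[OF smooth_uvw(2)] v12 v22 v32]) (assumption | rule that)+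
  have u21: "partial 2 (partial 1 u) p = 0" "partial 3 (partial 1 u) p = 0" if p: "p \<in> M" for p
    using u12[OF p] u13[OF p] w1[OF p] v1[OF p] by (simp_all add: comm p)
  obtain c3 where c3: "\<And>p. p \<in> M \<Longrightarrow> partial 1 u p = c3"
    by (rule const_on_M[OF smooth_on_partial[OF smooth_uvw(1)] u11 u21]) (assumption | rule that)+
  have u22': "partial 2 (partial 2 u) p = 0" if p: "p \<in> M" for p
    using u22[OF p] w2[OF p] by simp
  \<comment> \<open>Adding the xy equation for \<open>u\<close> and the yy equation for
    \<open>v\<close> cancels v f_xx + w f_xy, in which \<open>v\<close> and \<open>w\<close> are
    still unknown. The coefficient of f_x is constant, so one further x-derivative at a single point
    forces 2 d = c1 + c3.\<close>
  have sum: "2 * (partial 2 (partial 3 u) p + partial 3 (partial 3 v) p) + (2 * d - c1 - c3) * Fx p = 0"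
    if p: "p \<in> M" for p
    using u23[OF p] v33[OF p] unfolding c1[OF p] c3[OF p] d[OF p] w1[OF p] w2[OF p] v1[OF p]
    by (simp add: algebra_simps)
  obtain p0 where p0: "p0 \<in> M"
    using T I J vector_in_M by (auto simp: open_interval_def)
  have "(2 * d - c1 - c3) * partial 2 Fx p0 = 0"
    using partial_eq_zeroI[OF _ p0 sum, of "\<lambda>q. q" 2] d232[OF smooth_uvw(1) u22' p0] d233[OF smooth_uvw(2) v23'' p0]
    by (simp add: sm p0)
  then have d0: "2 * d - c1 - c3 = 0" using Fxx[OF p0] by simp
  then have d_eq: "d = (c1 + c3) / 2" by simp
  have u23': "partial 2 (partial 3 u) p + partial 3 (partial 3 v) p = 0" if p: "p \<in> M" for p
    using sum[OF p] unfolding d0 by simp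
  \<comment> \<open>All three partials of u_x + v_y vanish; the last one is \<open>sum\<close> once
    its coefficient of f_x is known to be zero.\<close>
  obtain \<kappa> where \<kappa>: "\<And>p. p \<in> M \<Longrightarrow> partial 2 u p + partial 3 v p = \<kappa>"
  proof (rule const_on_M[of "\<lambda>p. partial 2 u p + partial 3 v p"])
    show "partial 1 (\<lambda>p. partial 2 u p + partial 3 v p) q = 0" if q: "q \<in> M" for q
      using u12[OF q] v13[OF q] w1[OF q] by (simp add: sm q)
    show "partial 2 (\<lambda>p. partial 2 u p + partial 3 v p) q = 0" if q: "q \<in> M" for q
      using u22'[OF q] v23''[OF q] by (simp add: sm q)
    show "partial 3 (\<lambda>p. partial 2 u p + partial 3 v p) q = 0" if q: "q \<in> M" for q
      using u23'[OF q] by (simp add: sm q)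
  qed (assumption | rule that | simp add: sm)+
  \<comment> \<open>\<open>\<kappa> = 0\<close>, since computing the mixed second derivative of \<open>?S\<close> in both orders gives \<open>0\<close> and \<open>- \<kappa> f\<^sub>x\<^sub>x\<close>.\<close>
  let ?S = "structure_fun (c1 - c3)"
  have S2: "partial 2 ?S p = 0" and S3: "partial 3 ?S p = - \<kappa> * Fx p" if p: "p \<in> M" for p
  proof -
    note c = c1[OF p] c3[OF p] d[OF p] w1[OF p] w2[OF p] v1[OF p]
    show "partial 2 ?S p = 0"
      using u23[OF p] unfolding partial_structure_fun[OF p] c d_eq by (simp add: field_simps)
    show "partial 3 ?S p = - \<kappa> * Fx p"
      using u33[OF p] unfolding partial_structure_fun[OF p] c \<kappa>[OF p, symmetric] by (simp add: algebra_simps)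
  qed
  have "partial 2 (partial 3 ?S) p0 = 0"
    using partial_eq_zeroI[OF smooth_on_partial[OF smooth_structure_fun] p0 S2, of 3]
      partial_commutes(3)[OF smooth_structure_fun p0] by simp
  moreover have "partial 2 (partial 3 ?S) p0 = partial 2 (\<lambda>p. - \<kappa> * Fx p) p0"
    by (rule partial_eq[OF S3 smooth_on_partial[OF smooth_structure_fun] p0])
  moreover have "\<dots> = - \<kappa> * partial 2 Fx p0"
    by (subst partial_mult[where S = M]) (simp_all add: smooth_simps p0)
  ultimately have "\<kappa> * partial 2 Fx p0 = 0" by simp
  then have "\<kappa> = 0" using Fxx[OF p0] by simp
  then have "normal_eqs c1 c3 ((c1 + c3) / 2) p" if p: "p \<in> M" for p
    using w1[OF p] w2[OF p] c1[OF p] v1[OF p] d[OF p] d_eq c3[OF p] \<kappa>[OF p] unfolding normal_eqs_def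
    by simp
  then show thesis by (rule that)
qed

lemma normal_eqs_second_partials:
  assumes ne: "\<And>p. p \<in> M \<Longrightarrow> normal_eqs c1 c3 d p" and p: "p \<in> M"
  shows "partial i (partial 1 w) p = 0" "partial i (partial 2 w) p = 0" "partial i (partial 3 w) p = 0"
    "partial i (partial 1 v) p = 0" "partial i (partial 2 v) p = 0"
    "partial 1 (partial 3 v) p = 0" "partial 2 (partial 3 v) p = 0"
    "partial i (partial 1 u) p = 0" "partial i (partial 2 u) p = - partial i (partial 3 v) p"
    "partial 1 (partial 3 u) p = 0" "partial 2 (partial 3 u) p = - partial 3 (partial 3 v) p"
proof -
  note e = ne[unfolded normal_eqs_def]
  have const: "partial i h p = 0" if "\<And>q. q \<in> M \<Longrightarrow> h q = c" "smooth_on M h" for i h c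
    using partial_eq[OF that p, of i] by simp
  show a: "partial i (partial 1 w) p = 0" "partial i (partial 2 w) p = 0" "partial i (partial 3 w) p = 0"
    "partial i (partial 1 v) p = 0" "partial i (partial 2 v) p = 0" "partial i (partial 1 u) p = 0" for i
    by (rule const[of _ 0] const[of _ c1] const[of _ d] const[of _ c3]; simp add: e smooth_simps)+
  show "partial 1 (partial 3 v) p = 0" "partial 2 (partial 3 v) p = 0" "partial 1 (partial 3 u) p = 0"
    using a(4-6)[of 3] by (simp_all add: partial_commutes[OF _ p] smooth_uvw)
  show b: "partial i (partial 2 u) p = - partial i (partial 3 v) p" for i
  proof -
    have "partial i (\<lambda>q. partial 2 u q + partial 3 v q) p = 0"
      by (rule partial_eq_zeroI[OF _ p]) (simp_all add: e smooth_simps)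
    then show ?thesis by (simp add: smooth_simps partial_simps p)
  qed
  show "partial 2 (partial 3 u) p = - partial 3 (partial 3 v) p"
    using b[of 3] partial_commutes(3)[OF smooth_uvw(1) p] by simp
qed

text \<open>In normal form the \<open>v\<close> yy equation and the \<open>u\<close> xy equation
  differ only in sign, since u_xy = - v_yy. Doubling the \<open>u\<close> xy and yy equations gives
  the x- and y-partials of \<open>structure_fun\<close>; the other equations hold
  identically.\<close>

lemma affine_eqs_iff_structure_fun:
  assumes ne: "\<And>p. p \<in> M \<Longrightarrow> normal_eqs c1 c3 ((c1 + c3) / 2) p" and p: "p \<in> M"
  shows "affine_eqs p \<longleftrightarrow>
    partial 2 (structure_fun (c1 - c3)) p = 0 \<and> partial 3 (structure_fun (c1 - c3)) p = 0"
proof -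
  have "partial 1 w p = 0" "partial 2 w p = 0" "partial 3 w p = c1" "partial 1 v p = 0"
    "partial 2 v p = (c1 + c3) / 2" "partial 1 u p = c3" "partial 2 u p = - partial 3 v p"
    using ne[OF p] by (simp_all add: normal_eqs_def)
  note n = this normal_eqs_second_partials[OF ne p]
  show ?thesis
    unfolding affine_eqs_def partial_structure_fun[OF p]
    by (simp add: n) (auto simp: field_simps)
qed

lemma affine_characterization:
  assumes Fxx: "\<And>p. p \<in> M \<Longrightarrow> partial 2 Fx p \<noteq> 0"
  shows "affine_vf_on M g X \<longleftrightarrow>
    (\<exists>c1 c2 c3 c4 f1 f2. normal_form c1 c2 c3 ((c1 + c3) / 2) f1 f2 \<and>
      (\<forall>x\<in>I. \<forall>y\<in>J. (c1 - c3) * f x y - 2 * deriv (deriv f1) y * x + 2 * deriv f2 y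
          + ((c1 + c3) / 2 * x + f1 y) * dx f x y + (c1 * y + c2) * dy f x y + c4 = 0))"
    (is "_ \<longleftrightarrow> (\<exists>c1 c2 c3 c4 f1 f2. ?P c1 c2 c3 c4 f1 f2)")
proof
  assume "affine_vf_on M g X"
  then have aff: "\<And>p. p \<in> M \<Longrightarrow> affine_eqs p" by (simp add: affine_iff)
  obtain c1 c3 where ne: "\<And>p. p \<in> M \<Longrightarrow> normal_eqs c1 c3 ((c1 + c3) / 2) p"
    by (rule affine_imp_normal_eqs[OF Fxx aff]) (assumption | rule that)+
  obtain c2 f1 f2 where nf: "normal_form c1 c2 c3 ((c1 + c3) / 2) f1 f2"
    by (rule normal_form_exists[OF ne])
  let ?S = "structure_fun (c1 - c3)"
  have S1: "partial 1 ?S p = 0" if "p \<in> M" for p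
    using normal_eqs_second_partials(10)[OF ne that] ne[OF that]
    by (simp add: partial_structure_fun[OF that] normal_eqs_def)
  have S23: "partial 2 ?S p = 0" "partial 3 ?S p = 0" if "p \<in> M" for p
    using aff[OF that] affine_eqs_iff_structure_fun[OF ne that] by blast+
  \<comment> \<open>The t-partial vanishes as well because u_ty = v_t = w_t = 0, so the left-hand
    side is a constant \<open>c\<close>, and - c serves as \<open>c4\<close>.\<close>
  obtain c where c: "\<And>p. p \<in> M \<Longrightarrow> ?S p = c"
    by (rule const_on_M[OF smooth_structure_fun S1 S23]) (assumption | rule that)+
  then have "\<forall>p\<in>M. (c1 - c3) * F p + 2 * partial 3 u p + v p * Fx p + w p * Fy p + (- c) = 0"
    by (simp add: structure_fun_def)
  then have "?P c1 c2 c3 (- c) f1 f2"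
    using nf unfolding structure_equation_iff[OF nf, symmetric] by blast
  then show "\<exists>c1 c2 c3 c4 f1 f2. ?P c1 c2 c3 c4 f1 f2" by blast
next
  assume "\<exists>c1 c2 c3 c4 f1 f2. ?P c1 c2 c3 c4 f1 f2"
  then obtain c1 c2 c3 c4 f1 f2 where nf: "normal_form c1 c2 c3 ((c1 + c3) / 2) f1 f2"
    and P: "?P c1 c2 c3 c4 f1 f2" by blast
  from P have "\<forall>p\<in>M. (c1 - c3) * F p + 2 * partial 3 u p + v p * Fx p + w p * Fy p + c4 = 0"
    unfolding structure_equation_iff[OF nf] by blast
  then have S: "structure_fun (c1 - c3) p = - c4" if "p \<in> M" for p
    using that by (auto simp: structure_fun_def add_eq_0_iff2)
  have "partial i (structure_fun (c1 - c3)) p = 0" if "p \<in> M" for i p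
    using partial_eq[OF S smooth_structure_fun that, of i] by simp
  then show "affine_vf_on M g X"
    unfolding affine_iff using affine_eqs_iff_structure_fun[OF normal_formD(1)[OF nf]] by blast
qed

section \<open>Killing fields and the final equivalences\<close>

lemma killing_iff_homothetic_const_zero: "killing_on M g X \<longleftrightarrow> homothetic_const_on M g 0 X"
  by (simp add: killing_on_def homothetic_const_on_def)

text \<open>The xx equation reads 2 v_x = eta, so one point of the nonempty box determines the
  constant.\<close>

lemma homothetic_const_unique:
  assumes "homothetic_const_on M g \<eta> X" "homothetic_const_on M g \<eta>' X"
  shows "\<eta> = \<eta>'"
proof -
  obtain p where p: "p \<in> M"
    using T I J vector_in_M by (auto simp: open_interval_def)
  show ?thesis
    using homothetic_const_iff[of \<eta>] homothetic_const_iff[of \<eta>'] assms p by (auto simp: homothetic_eqs_def)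
qed

end

theorem theorem3p1:
  fixes f :: "real \<Rightarrow> real \<Rightarrow> real"
    and T I J :: "real set"
    and M :: "(real^3) set"
    and g :: "real^3 \<Rightarrow> real^3^3"
    and X :: "real^3 \<Rightarrow> real^3"
  assumes "open_interval T" "open_interval I" "open_interval J"
    and f_smooth: "smooth_on (I \<times> J) (\<lambda>(x, y). f x y)"
    and fxx: "\<And>x y. x \<in> I \<Longrightarrow> y \<in> J \<Longrightarrow> dx (dx f) x y \<noteq> 0"
    and M_def: "M = coord_box T I J"
    and g_def: "g = walker_metric f"
    and X_smooth: "smooth_on M X"
  shows
    "(killing_on M g X \<longleftrightarrow>
      (\<exists>(c1::real) (c2::real) (f1::real \<Rightarrow> real) (f2::real \<Rightarrow> real).
        smooth_on J f1 \<and> smooth_on J f2 \<and>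
        (\<forall>t\<in>T. \<forall>x\<in>I. \<forall>y\<in>J. X (vector [t, x, y]) =
          vector [- c1 * t - x * deriv f1 y + f2 y, f1 y, c1 * y + c2]) \<and>
        (\<forall>x\<in>I. \<forall>y\<in>J. 2 * c1 * f x y - 2 * deriv (deriv f1) y * x + 2 * deriv f2 y
          + f1 y * dx f x y + (c1 * y + c2) * dy f x y = 0)))
    \<and> (homothetic_on M g X \<and> \<not> killing_on M g X \<longleftrightarrow>
      (\<exists>(\<eta>::real) (c1::real) (c2::real) (f1::real \<Rightarrow> real) (f2::real \<Rightarrow> real).
        \<eta> \<noteq> 0 \<and> smooth_on J f1 \<and> smooth_on J f2 \<and>
        (\<forall>t\<in>T. \<forall>x\<in>I. \<forall>y\<in>J. X (vector [t, x, y]) =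
          vector [\<eta> * t - c1 * t - x * deriv f1 y + f2 y, \<eta> / 2 * x + f1 y, c1 * y + c2]) \<and>
        (\<forall>x\<in>I. \<forall>y\<in>J. (2 * c1 - \<eta>) * f x y - 2 * deriv (deriv f1) y * x + 2 * deriv f2 y
          + (\<eta> / 2 * x + f1 y) * dx f x y + (c1 * y + c2) * dy f x y = 0)))
    \<and> (\<forall>\<eta>::real. \<eta> \<noteq> 0 \<longrightarrow> (homothetic_const_on M g \<eta> X \<longleftrightarrow>
      (\<exists>(c1::real) (c2::real) (f1::real \<Rightarrow> real) (f2::real \<Rightarrow> real).
        smooth_on J f1 \<and> smooth_on J f2 \<and>
        (\<forall>t\<in>T. \<forall>x\<in>I. \<forall>y\<in>J. X (vector [t, x, y]) =
          vector [\<eta> * t - c1 * t - x * deriv f1 y + f2 y, \<eta> / 2 * x + f1 y, c1 * y + c2]) \<and>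
        (\<forall>x\<in>I. \<forall>y\<in>J. (2 * c1 - \<eta>) * f x y - 2 * deriv (deriv f1) y * x + 2 * deriv f2 y
          + (\<eta> / 2 * x + f1 y) * dx f x y + (c1 * y + c2) * dy f x y = 0))))
    \<and> (affine_vf_on M g X \<longleftrightarrow>
      (\<exists>(c1::real) (c2::real) (c3::real) (c4::real) (f1::real \<Rightarrow> real) (f2::real \<Rightarrow> real).
        smooth_on J f1 \<and> smooth_on J f2 \<and>
        (\<forall>t\<in>T. \<forall>x\<in>I. \<forall>y\<in>J. X (vector [t, x, y]) =
          vector [c3 * t - x * deriv f1 y + f2 y, (c1 + c3) / 2 * x + f1 y, c1 * y + c2]) \<and>
        (\<forall>x\<in>I. \<forall>y\<in>J. (c1 - c3) * f x y - 2 * deriv (deriv f1) y * x + 2 * deriv f2 y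
          + ((c1 + c3) / 2 * x + f1 y) * dx f x y + (c1 * y + c2) * dy f x y + c4 = 0)))"
proof -
  interpret walker_field f T I J X
    using assms by unfold_locales auto
  have Fxx: "partial 2 Fx p \<noteq> 0" if "p \<in> coord_box T I J" for p
  proof -
    have "p $ 1 \<in> T" "p $ 2 \<in> I" "p $ 3 \<in> J" using that by (simp_all add: coord_box_def)
    from dx_dx_eq[OF this] fxx[OF this(2,3)] show ?thesis by (simp add: vector_collapse3)
  qed
  have hom: "homothetic_const_on M g \<eta> X \<longleftrightarrow>
      (\<exists>c1 c2 f1 f2. smooth_on J f1 \<and> smooth_on J f2 \<and>
        (\<forall>t\<in>T. \<forall>x\<in>I. \<forall>y\<in>J. X (vector [t, x, y]) =
          vector [\<eta> * t - c1 * t - x * deriv f1 y + f2 y, \<eta> / 2 * x + f1 y, c1 * y + c2]) \<and>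
        (\<forall>x\<in>I. \<forall>y\<in>J. (2 * c1 - \<eta>) * f x y - 2 * deriv (deriv f1) y * x + 2 * deriv f2 y
          + (\<eta> / 2 * x + f1 y) * dx f x y + (c1 * y + c2) * dy f x y = 0))" for \<eta>
  proof -
    have "\<eta> * t - c * t = (\<eta> - c) * t" for c t by (simp add: left_diff_distrib)
    then show ?thesis
      using homothetic_const_characterization[OF Fxx, of \<eta>]
      unfolding M_def g_def normal_form_def by (simp only: add_0_right conj_assoc)
  qed
  have kill: "killing_on M g X \<longleftrightarrow> homothetic_const_on M g 0 X"
    unfolding M_def g_def by (rule killing_iff_homothetic_const_zero)
  have uniq: "\<eta> = 0" if "homothetic_const_on M g \<eta> X" "homothetic_const_on M g 0 X" for \<eta>
    using that unfolding M_def g_def by (rule homothetic_const_unique)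
  \<comment> \<open>Killing means constant 0, and by uniqueness a field with a nonzero constant
    cannot also have constant 0.\<close>
  have "homothetic_on M g X \<and> \<not> killing_on M g X \<longleftrightarrow> (\<exists>\<eta>. \<eta> \<noteq> 0 \<and> homothetic_const_on M g \<eta> X)"
    unfolding kill homothetic_on_def using uniq by metis
  moreover have "affine_vf_on M g X \<longleftrightarrow>
      (\<exists>(c1::real) (c2::real) (c3::real) (c4::real) (f1::real \<Rightarrow> real) (f2::real \<Rightarrow> real).
        smooth_on J f1 \<and> smooth_on J f2 \<and>
        (\<forall>t\<in>T. \<forall>x\<in>I. \<forall>y\<in>J. X (vector [t, x, y]) =
          vector [c3 * t - x * deriv f1 y + f2 y, (c1 + c3) / 2 * x + f1 y, c1 * y + c2]) \<and>
        (\<forall>x\<in>I. \<forall>y\<in>J. (c1 - c3) * f x y - 2 * deriv (deriv f1) y * x + 2 * deriv f2 y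
          + ((c1 + c3) / 2 * x + f1 y) * dx f x y + (c1 * y + c2) * dy f x y + c4 = 0))"
    using affine_characterization[OF Fxx] unfolding M_def g_def normal_form_def by (simp only: conj_assoc)
  moreover have "killing_on M g X \<longleftrightarrow>
      (\<exists>(c1::real) (c2::real) (f1::real \<Rightarrow> real) (f2::real \<Rightarrow> real).
        smooth_on J f1 \<and> smooth_on J f2 \<and>
        (\<forall>t\<in>T. \<forall>x\<in>I. \<forall>y\<in>J. X (vector [t, x, y]) =
          vector [- c1 * t - x * deriv f1 y + f2 y, f1 y, c1 * y + c2]) \<and>
        (\<forall>x\<in>I. \<forall>y\<in>J. 2 * c1 * f x y - 2 * deriv (deriv f1) y * x + 2 * deriv f2 y
          + f1 y * dx f x y + (c1 * y + c2) * dy f x y = 0))"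
    unfolding kill hom by simp
  ultimately show ?thesis
    unfolding hom by blast
qed

end
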